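(* Let $\Omega\subset\mathbb{R}^n$ be a bounded connected Lipschitz domain, $1<q<\infty$, $0\le\lambda<n$, and let $U\subset\Omega$ be measurable with positive measure. Then there is $c>0$ such that $\|f\|_{M_{q,\lambda}(\Omega)}\le c\|\nabla f\|_{M_{q,\lambda}(\Omega)}$ for every $f$ which either (a) lies in $L^1(\Omega)$ with $\nabla f\in\mathring{M}_{q,\lambda}(\Omega)$ and $\int_Uf=0$, or (b) lies in $W^1_0\mathring{M}_{q,\lambda}(\Omega)$.
   Context: For $x\in\mathbb{R}^n$, $R>0$: $\Omega_R(x):=\Omega\cap B(x,R)$. Morrey space $M_{q,\lambda}(\Omega)$: all $f\in L^q_{\mathrm{loc}}(\overline{\Omega})$ with $\|f\|_{M_{q,\lambda}(\Omega)}:=\sup\{R^{-\lambda/q}\|f\|_{L^q(\Omega_R(x))}: R>0,\ x\in\Omega\}<\infty$. Zorko space $\mathring{M}_{q,\lambda}(\Omega)$: closure of $C_0^\infty(\overline{\Omega})$ in $M_{q,\lambda}(\Omega)$. $W^1\mathring{M}_{q,\lambda}(\Omega)$: $f\in\mathring{M}_{q,\lambda}(\Omega)$ with weak gradient in $\mathring{M}_{q,\lambda}(\Omega)$, norm $\max(\|f\|,\|\nabla f\|)$; $W^1_0\mathring{M}_{q,\lambda}(\Omega)$: closure of $C_0^\infty(\Omega)$ in it. Lipschitz domain: boundary locally the graph of a Lipschitz function. *)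

theory Defs
  imports "HOL-Analysis.Analysis"
begin

text \<open>Lipschitz domain: open set whose boundary is locally (after a rotation, encoded by
  a unit direction e playing the role of the last coordinate axis) the graph of a
  Lipschitz function defined on the orthogonal hyperplane.\<close>
definition lipschitz_domain :: "'a::euclidean_space set \<Rightarrow> bool" where
  "lipschitz_domain \<Omega> \<longleftrightarrow> open \<Omega> \<and>
     (\<forall>p\<in>frontier \<Omega>. \<exists>r>0. \<exists>e h L. norm e = 1 \<and>
        lipschitz_on L {y. y \<bullet> e = 0} (h :: 'a \<Rightarrow> real) \<and>
        \<Omega> \<inter> ball p r = {x \<in> ball p r. x \<bullet> e < h (x - (x \<bullet> e) *\<^sub>R e)})"

fun Ck :: "nat \<Rightarrow> ('a::euclidean_space \<Rightarrow> 'b::real_normed_vector) \<Rightarrow> bool" where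
  "Ck 0 f \<longleftrightarrow> continuous_on UNIV f"
| "Ck (Suc k) f \<longleftrightarrow> continuous_on UNIV f \<and> (\<forall>x. f differentiable (at x)) \<and>
     (\<forall>i\<in>Basis. Ck k (\<lambda>x. frechet_derivative f (at x) i))"

definition smooth :: "('a::euclidean_space \<Rightarrow> 'b::real_normed_vector) \<Rightarrow> bool" where
  "smooth f \<longleftrightarrow> (\<forall>k. Ck k f)"

definition tsupport :: "('a::euclidean_space \<Rightarrow> 'b::real_normed_vector) \<Rightarrow> 'a set" where
  "tsupport f = closure {x. f x \<noteq> 0}"

text \<open>C_0^\<infinity>(closure \<Omega>): (restrictions to \<Omega> of) smooth compactly supported functions on R^n.\<close>
definition C0inf_closure :: "('a::euclidean_space \<Rightarrow> 'b::real_normed_vector) \<Rightarrow> bool" where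
  "C0inf_closure \<phi> \<longleftrightarrow> smooth \<phi> \<and> compact (tsupport \<phi>)"

definition C0inf :: "'a::euclidean_space set \<Rightarrow> ('a \<Rightarrow> 'b::real_normed_vector) \<Rightarrow> bool" where
  "C0inf \<Omega> \<phi> \<longleftrightarrow> smooth \<phi> \<and> compact (tsupport \<phi>) \<and> tsupport \<phi> \<subseteq> \<Omega>"

definition grad :: "('a::euclidean_space \<Rightarrow> real) \<Rightarrow> 'a \<Rightarrow> 'a" where
  "grad \<phi> x = (\<Sum>i\<in>Basis. frechet_derivative \<phi> (at x) i *\<^sub>R i)"

definition local_Lq :: "real \<Rightarrow> 'a::euclidean_space set \<Rightarrow> ('a \<Rightarrow> 'b::real_normed_vector) \<Rightarrow> real" where
  "local_Lq q S f = (LINT y:S|lebesgue. norm (f y) powr q) powr (1 / q)"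

definition morrey_vals :: "real \<Rightarrow> real \<Rightarrow> 'a::euclidean_space set \<Rightarrow> ('a \<Rightarrow> 'b::real_normed_vector) \<Rightarrow> real set" where
  "morrey_vals q lam \<Omega> f = {R powr (- lam / q) * local_Lq q (\<Omega> \<inter> ball x R) f | x R. x \<in> \<Omega> \<and> R > 0}"

definition in_morrey :: "real \<Rightarrow> real \<Rightarrow> 'a::euclidean_space set \<Rightarrow> ('a \<Rightarrow> 'b::{real_normed_vector, second_countable_topology}) \<Rightarrow> bool" where
  "in_morrey q lam \<Omega> f \<longleftrightarrow> f \<in> borel_measurable (lebesgue_on \<Omega>) \<and>
     (\<forall>x R. set_integrable lebesgue (\<Omega> \<inter> ball x R) (\<lambda>y. norm (f y) powr q)) \<and>
     bdd_above (morrey_vals q lam \<Omega> f)"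

definition morrey_norm :: "real \<Rightarrow> real \<Rightarrow> 'a::euclidean_space set \<Rightarrow> ('a \<Rightarrow> 'b::real_normed_vector) \<Rightarrow> real" where
  "morrey_norm q lam \<Omega> f = Sup (morrey_vals q lam \<Omega> f)"

definition in_zorko :: "real \<Rightarrow> real \<Rightarrow> 'a::euclidean_space set \<Rightarrow> ('a \<Rightarrow> 'b::{real_normed_vector, second_countable_topology}) \<Rightarrow> bool" where
  "in_zorko q lam \<Omega> f \<longleftrightarrow> in_morrey q lam \<Omega> f \<and>
     (\<forall>\<epsilon>>0. \<exists>\<phi>. C0inf_closure \<phi> \<and> in_morrey q lam \<Omega> (\<lambda>x. f x - \<phi> x) \<and>
        morrey_norm q lam \<Omega> (\<lambda>x. f x - \<phi> x) < \<epsilon>)"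

definition weak_grad :: "'a::euclidean_space set \<Rightarrow> ('a \<Rightarrow> real) \<Rightarrow> ('a \<Rightarrow> 'a) \<Rightarrow> bool" where
  "weak_grad \<Omega> f g \<longleftrightarrow>
     (\<forall>K. compact K \<and> K \<subseteq> \<Omega> \<longrightarrow> set_integrable lebesgue K f \<and> set_integrable lebesgue K g) \<and>
     (\<forall>\<phi>::'a \<Rightarrow> real. C0inf \<Omega> \<phi> \<longrightarrow> (\<forall>i\<in>Basis.
        (LINT x:\<Omega>|lebesgue. f x * frechet_derivative \<phi> (at x) i) =
        - (LINT x:\<Omega>|lebesgue. (g x \<bullet> i) * \<phi> x)))"

definition in_W10_zorko :: "real \<Rightarrow> real \<Rightarrow> 'a::euclidean_space set \<Rightarrow> ('a \<Rightarrow> real) \<Rightarrow> ('a \<Rightarrow> 'a) \<Rightarrow> bool" where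
  "in_W10_zorko q lam \<Omega> f g \<longleftrightarrow> weak_grad \<Omega> f g \<and> in_zorko q lam \<Omega> f \<and> in_zorko q lam \<Omega> g \<and>
     (\<forall>\<epsilon>>0. \<exists>\<phi>. C0inf \<Omega> \<phi> \<and>
        in_morrey q lam \<Omega> (\<lambda>x. f x - \<phi> x) \<and> in_morrey q lam \<Omega> (\<lambda>x. g x - grad \<phi> x) \<and>
        max (morrey_norm q lam \<Omega> (\<lambda>x. f x - \<phi> x)) (morrey_norm q lam \<Omega> (\<lambda>x. g x - grad \<phi> x)) < \<epsilon>)"

end

theory Submission
  imports Defs "HOL-Computational_Algebra.Polynomial" "HOL-Probability.Probability_Measure"
begin

text \<open>
  Everything rests on one estimate. If \<open>x + s v \<in> \<Omega>\<close> for all \<open>x \<in> S\<close> and \<open>0 \<le> s \<le> 1\<close>, then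
  \<open>f (x + v) - f x\<close> is the integral of \<open>\<nabla>f (x + s v) \<bullet> v\<close> over \<open>0 \<le> s \<le> 1\<close> for almost every \<open>x \<in> S\<close>.
  By Jensen's inequality and Fubini, \<open>f (\<cdot> + v) - f\<close> is therefore bounded on \<open>S\<close> by \<open>|v|\<close> times
  the Morrey norm of the gradient, since the Morrey norm is insensitive to translations.

  Averaging over \<open>v\<close> gives the Poincare inequality on balls contained in \<open>\<Omega>\<close>. Near a boundary point,
  \<open>\<Omega>\<close> lies below a Lipschitz graph, so that a small piece of \<open>\<Omega>\<close> can be pushed down along the graph
  axis into such a ball, and the inequality on the ball is pulled back. Two overlapping pieces share
  their constants up to the gradient, hence compactness of the closure and connectedness yield the
  inequality on \<open>\<Omega>\<close>. The condition \<open>\<integral>\<^sub>U f = 0\<close> then bounds the remaining constant. For the closure of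
  the test functions one translates by a vector longer than the diameter of \<open>\<Omega>\<close>.
\<close>

subsection \<open>Smooth bump functions\<close>

text \<open>Smooth functions are not dense in a Morrey space in general, so the translation identity
  is proved by duality: the increment of \<open>f\<close> is moved onto a test function, where the
  classical fundamental theorem applies. The test functions are explicit bumps on boxes, a family
  preserved by translations and converging to indicators of boxes, which suffice to detect a null
  function. The norm uses balls centred in \<open>\<Omega>\<close> only, and translations do not
  respect this. Gradients are therefore extended by zero and bounded over balls with arbitrary
  centres, at the price of a factor \<open>2 powr lam\<close>. In case (a) \<open>f\<close> is known
  beforehand to be integrable only, so its Morrey norm may not be assumed finite; the bounds are
  inequalities between nonnegative extended integrals, and membership in the Morrey space comes out
  at the end. Bounds are kept for \<open>q\<close>-th powers, so that they are linear in the bound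
  \<open>K\<close> of the gradient until the final root.\<close>

lemma Ck_imp_continuous: "Ck k f \<Longrightarrow> continuous_on UNIV f"
  by (cases k) auto

lemma Ck_Suc_imp_Ck: "Ck (Suc k) f \<Longrightarrow> Ck k f"
proof (induction k arbitrary: f)
  case 0
  then show ?case by simp
next
  case (Suc k)
  then show ?case using Ck.simps(2) by blast
qed

lemma Ck_const: "Ck k (\<lambda>_. c)"
  by (induction k arbitrary: c) (auto simp: frechet_derivative_const)

text \<open>Lets the inductions below supply a derivative by an explicit formula in place of
  \<open>frechet_derivative\<close>.\<close>

lemma Ck_SucI:
  assumes "\<And>x. (f has_derivative f' x) (at x)" "\<And>i. i \<in> Basis \<Longrightarrow> Ck k (\<lambda>x. f' x i)"
  shows "Ck (Suc k) f"
proof -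
  have "frechet_derivative f (at x) = f' x" for x
    using frechet_derivative_at[OF assms(1)] by metis
  moreover have "continuous_on UNIV f"
    using assms(1) has_derivative_continuous continuous_at_imp_continuous_on by blast
  ultimately show ?thesis
    using assms by (auto simp: differentiable_def)
qed

lemma Ck_add: "Ck k f \<Longrightarrow> Ck k g \<Longrightarrow> Ck k (\<lambda>x. f x + g x)"
proof (induction k arbitrary: f g)
  case 0
  then show ?case by (auto intro: continuous_intros)
next
  case (Suc k)
  show ?case
  proof (rule Ck_SucI)
    show "((\<lambda>x. f x + g x) has_derivative
        (\<lambda>h. frechet_derivative f (at x) h + frechet_derivative g (at x) h)) (at x)" for x
      using Suc.prems by (intro has_derivative_add) (auto simp: frechet_derivative_works)
  qed (use Suc in auto)
qed

lemma Ck_mult: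
  fixes f g :: "'a::euclidean_space \<Rightarrow> real"
  shows "Ck k f \<Longrightarrow> Ck k g \<Longrightarrow> Ck k (\<lambda>x. f x * g x)"
proof (induction k arbitrary: f g)
  case 0
  then show ?case by (auto intro: continuous_intros)
next
  case (Suc k)
  show ?case
  proof (rule Ck_SucI)
    show "((\<lambda>x. f x * g x) has_derivative
        (\<lambda>h. f x * frechet_derivative g (at x) h + frechet_derivative f (at x) h * g x)) (at x)" for x
      using Suc.prems by (intro has_derivative_mult) (auto simp: frechet_derivative_works)
    show "Ck k (\<lambda>x. f x * frechet_derivative g (at x) i + frechet_derivative f (at x) i * g x)"
      if "i \<in> Basis" for i
      using that Suc.prems by (intro Ck_add Suc.IH) (auto intro: Ck_Suc_imp_Ck simp del: Ck.simps(1))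
  qed
qed

lemma Ck_prod:
  fixes f :: "'i \<Rightarrow> 'a::euclidean_space \<Rightarrow> real"
  assumes "\<And>i. i \<in> I \<Longrightarrow> Ck k (f i)"
  shows "Ck k (\<lambda>x. \<Prod>i\<in>I. f i x)"
  using assms by (induction I rule: infinite_finite_induct) (auto intro: Ck_const Ck_mult)

text \<open>The functions p(1/t) exp(-1/t), extended by 0, form a class closed under
  differentiation: the derivative replaces p by x^2 (p - p'). Smoothness of the standard flat
  function, the case p = 1, follows by an induction over the whole class.\<close>

definition flatexp :: "real poly \<Rightarrow> real \<Rightarrow> real" where
  "flatexp p t = (if t > 0 then poly p (1 / t) * exp (- (1 / t)) else 0)"

lemma poly_over_exp_tendsto_0: "((\<lambda>x. poly p x * exp (- x)) \<longlongrightarrow> (0::real)) at_top"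
proof -
  have "((\<lambda>x. \<Sum>i\<le>degree p. coeff p i * (x ^ i / exp x)) \<longlongrightarrow> (\<Sum>i\<le>degree p. coeff p i * 0)) at_top"
    by (intro tendsto_intros tendsto_power_div_exp_0)
  then show ?thesis
    by (simp add: poly_altdef exp_minus field_simps sum_distrib_left sum_divide_distrib)
qed

lemma flatexp_tendsto_0: "(flatexp p \<longlongrightarrow> 0) (at 0)"
proof -
  have "(flatexp p \<longlongrightarrow> 0) (at_right 0)"
  proof (rule Lim_transform_eventually)
    show "((\<lambda>t. poly p (inverse t) * exp (- inverse t)) \<longlongrightarrow> 0) (at_right 0)"
      using filterlim_compose[OF poly_over_exp_tendsto_0 filterlim_inverse_at_top_right] by simp
    show "\<forall>\<^sub>F t in at_right 0. poly p (inverse t) * exp (- inverse t) = flatexp p t"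
      by (auto simp: eventually_at_right_field flatexp_def inverse_eq_divide intro!: exI[of _ 1])
  qed
  moreover have "(flatexp p \<longlongrightarrow> 0) (at_left 0)"
    by (rule Lim_transform_eventually[OF tendsto_const])
       (auto simp: eventually_at_left_field flatexp_def intro!: exI[of _ "-1"])
  ultimately show ?thesis by (simp add: filterlim_split_at)
qed

lemma flatexp_has_derivative:
  "(flatexp p has_field_derivative flatexp ([:0, 0, 1:] * (p - pderiv p)) t) (at t)"
proof -
  consider "t > 0" | "t < 0" | "t = 0" by linarith
  then show ?thesis
  proof cases
    case 1
    have "((\<lambda>t. poly p (1 / t) * exp (- (1 / t))) has_field_derivative
        flatexp ([:0, 0, 1:] * (p - pderiv p)) t) (at t)"
      using 1 by (auto intro!: derivative_eq_intros simp: flatexp_def field_simps power2_eq_square)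
    then show ?thesis
      by (rule DERIV_cong_ev[THEN iffD1, rotated -1])
         (use 1 in \<open>auto simp: flatexp_def eventually_nhds intro!: exI[of _ "{0<..}"]\<close>)
  next
    case 2
    have "((\<lambda>t. 0) has_field_derivative 0) (at t)" by simp
    then show ?thesis
      by (rule DERIV_cong_ev[THEN iffD1, rotated -1])
         (use 2 in \<open>auto simp: flatexp_def eventually_nhds intro!: exI[of _ "{..<0}"]\<close>)
  next
    case 3
    \<comment> \<open>Dividing by h multiplies the polynomial by x, so the difference quotient at 0
      stays in the class and tends to 0.\<close>
    have "(\<lambda>h. (flatexp p h - flatexp p 0) / (h - 0)) = flatexp ([:0, 1:] * p)"
      by (auto simp: flatexp_def fun_eq_iff)
    then show ?thesis
      using flatexp_tendsto_0[of "[:0, 1:] * p"] 3 by (simp add: has_field_derivative_iff flatexp_def)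
  qed
qed

text \<open>The induction keeps \<open>p\<close> arbitrary because every derivative changes the
  polynomial. Affine arguments are enough: each factor of a bump depends on one coordinate.\<close>

lemma Ck_flatexp_inner: "Ck k (\<lambda>x. flatexp p (x \<bullet> u + d))"
proof (induction k arbitrary: p)
  case 0
  have "isCont (flatexp p) t" for t using flatexp_has_derivative DERIV_isCont by blast
  then have "continuous_on UNIV (flatexp p)" by (simp add: continuous_at_imp_continuous_on)
  then show ?case
    by (auto intro!: continuous_intros continuous_on_compose2[of UNIV "flatexp p"])
next
  case (Suc k)
  show ?case
  proof (rule Ck_SucI)
    show "((\<lambda>x. flatexp p (x \<bullet> u + d)) has_derivative
      (\<lambda>h. flatexp ([:0, 0, 1:] * (p - pderiv p)) (x \<bullet> u + d) * (h \<bullet> u))) (at x)" for x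
      by (rule has_derivative_compose[OF _ flatexp_has_derivative[unfolded has_field_derivative_def]])
         (auto intro!: derivative_eq_intros)
    show "Ck k (\<lambda>x. flatexp ([:0, 0, 1:] * (p - pderiv p)) (x \<bullet> u + d) * (i \<bullet> u))" for i
      by (intro Ck_mult Suc Ck_const)
  qed
qed

text \<open>Each factor is exp(-1/t) at a scaled signed distance to a face of the box. As the scale
  \<open>Suc m\<close> grows, every factor inside the box tends to 1, and translating the argument
  only moves the corners. The successor keeps the scale positive.\<close>

definition bump :: "'a::euclidean_space \<Rightarrow> 'a \<Rightarrow> nat \<Rightarrow> 'a \<Rightarrow> real" where
  "bump a b m x = (\<Prod>i\<in>Basis. flatexp 1 (real (Suc m) * (x \<bullet> i - a \<bullet> i)) * flatexp 1 (real (Suc m) * (b \<bullet> i - x \<bullet> i)))"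

lemma smooth_bump: "smooth (bump a b m)"
proof -
  have *: "flatexp 1 (real (Suc m) * (x \<bullet> i - a \<bullet> i)) = flatexp 1 (x \<bullet> (real (Suc m) *\<^sub>R i) + - real (Suc m) * (a \<bullet> i))"
    "flatexp 1 (real (Suc m) * (b \<bullet> i - x \<bullet> i)) = flatexp 1 (x \<bullet> (- real (Suc m) *\<^sub>R i) + real (Suc m) * (b \<bullet> i))"
    for x i :: 'a by (simp_all add: algebra_simps)
  have "Ck k (\<lambda>x. \<Prod>i\<in>Basis. flatexp 1 (real (Suc m) * (x \<bullet> i - a \<bullet> i)) * flatexp 1 (real (Suc m) * (b \<bullet> i - x \<bullet> i)))" for k
    unfolding * by (intro Ck_prod Ck_mult Ck_flatexp_inner)
  then show ?thesis unfolding smooth_def bump_def[abs_def] by blast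
qed

lemma bump_translate: "bump a b m (x - v) = bump (a + v) (b + v) m x"
  unfolding bump_def by (simp add: algebra_simps inner_diff_left inner_add_left)

lemma bump_eq_0: "x \<notin> box a b \<Longrightarrow> bump a b m x = 0"
  unfolding bump_def by (force simp: mem_box flatexp_def zero_less_mult_iff not_less)

lemma flatexp_1_bounds: "0 \<le> flatexp 1 t" "flatexp 1 t \<le> 1"
  by (auto simp: flatexp_def)

lemma bump_bounds: "0 \<le> bump a b m x" "bump a b m x \<le> 1"
  unfolding bump_def
  by (auto intro!: prod_nonneg prod_le_1 mult_nonneg_nonneg mult_le_one flatexp_1_bounds)

lemma flatexp_1_tendsto:
  assumes "t > 0"
  shows "(\<lambda>m. flatexp 1 (real (Suc m) * t)) \<longlonglongrightarrow> 1"
proof -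
  have "(\<lambda>m. exp (- ((1 / t) * (1 / real (Suc m))))) \<longlonglongrightarrow> exp (- ((1 / t) * 0))"
    by (intro tendsto_intros LIMSEQ_Suc[OF lim_1_over_n])
  moreover have "exp (- ((1 / t) * (1 / real (Suc m)))) = flatexp 1 (real (Suc m) * t)" for m
    using assms by (simp add: flatexp_def zero_less_mult_iff field_simps add_pos_nonneg)
  ultimately show ?thesis by simp
qed

lemma bump_tendsto_indicator: "(\<lambda>m. bump a b m x) \<longlonglongrightarrow> indicator (box a b) x"
proof (cases "x \<in> box a b")
  case True
  have "(\<lambda>m. bump a b m x) \<longlonglongrightarrow> (\<Prod>i\<in>(Basis::'a set). 1 * 1)"
    unfolding bump_def using True by (intro tendsto_prod tendsto_mult flatexp_1_tendsto) (auto simp: mem_box)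
  then show ?thesis using True by simp
qed (simp add: bump_eq_0)

lemma tsupport_bump: "tsupport (bump a b m) \<subseteq> cbox a b"
  unfolding tsupport_def
  by (rule closure_minimal) (use bump_eq_0 box_subset_cbox in \<open>fastforce+\<close>)

lemma C0inf_bump: "cbox a b \<subseteq> \<Omega> \<Longrightarrow> C0inf \<Omega> (bump a b m)"
  unfolding C0inf_def using smooth_bump tsupport_bump[of a b m]
  by (auto simp: compact_eq_bounded_closed intro: bounded_subset[OF bounded_cbox])
    (simp add: tsupport_def)

subsection \<open>Morrey bounds\<close>

lemma ball_in_borel [measurable]: "ball (x::'a::metric_space) R \<in> sets borel"
  by (simp add: borel_open)

text \<open>Open boxes form an intersection-stable generator of the Borel sets, so vanishing
  integrals pass from boxes to all Borel sets by Dynkin's argument. Only boxes with closure in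
  \<open>S\<close> are available, hence the localisation to one box and the countable cover of
  \<open>S\<close> by closed boxes.\<close>

lemma box_integrals_zero_imp_AE_zero:
  fixes H :: "'a::euclidean_space \<Rightarrow> real"
  assumes "open S" and H: "integrable lborel H"
    and zero: "\<And>a b. cbox a b \<subseteq> S \<Longrightarrow> (LINT x:box a b|lborel. H x) = 0"
  shows "AE x in lborel. x \<in> S \<longrightarrow> H x = 0"
proof -
  have *: "AE x in lborel. x \<in> cbox a b \<longrightarrow> H x = 0" if ab: "cbox a b \<subseteq> S" for a b
  proof -
    \<comment> \<open>The cut-off lets arbitrary boxes serve as generators: their intersection with
      \<open>box a b\<close> is again a box, with closure in \<open>S\<close>.\<close>
    define F where "F x = indicator (box a b) x * H x" for x
    have F: "integrable lborel F"
      using integrable_mult_indicator[OF _ H, of "box a b"] by (simp add: F_def[abs_def])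
    have "integral\<^sup>L lborel F = 0"
      using zero[OF ab] by (simp add: F_def[abs_def] set_lebesgue_integral_def)
    have FA: "(LINT x:A|lborel. F x) = 0" if "A \<in> sets borel" for A
    proof -
      let ?E = "range (\<lambda>(a, b). box a b :: 'a set)"
      have "Int_stable ?E" by (auto simp: Int_stable_def box_Int_box)
      moreover have "?E \<subseteq> Pow UNIV" by simp
      moreover have "A \<in> sigma_sets UNIV ?E" using that by (simp add: borel_eq_box)
      ultimately show ?thesis
      proof (induction rule: sigma_sets_induct_disjoint)
        case (basic A)
        then obtain c d where A: "A = box c d" by auto
        obtain c' d' where cd: "box c d \<inter> box a b = box c' d'" by (auto simp: box_Int_box)
        have "(LINT x:A|lborel. F x) = (LINT x:box c' d'|lborel. H x)"
          unfolding set_lebesgue_integral_def F_def cd[symmetric] A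
          by (intro Bochner_Integration.integral_cong) (auto simp: indicator_def)
        also have "\<dots> = 0"
        proof (cases "box c' d' = {}")
          case False
          then have "cbox c' d' \<subseteq> S"
            using ab cd closure_mono[of "box c' d'" "cbox a b"] box_subset_cbox[of a b]
            by (auto simp: closure_box)
          then show ?thesis by (rule zero)
        qed (simp add: set_lebesgue_integral_def)
        finally show ?case .
      next
        case empty
        then show ?case by (simp add: set_lebesgue_integral_def)
      next
        case (compl A)
        then have A: "A \<in> sets lborel" by (simp add: borel_eq_box)
        have "(LINT x:UNIV - A|lborel. F x) = integral\<^sup>L lborel F - (LINT x:A|lborel. F x)"
          unfolding set_lebesgue_integral_def
          by (subst Bochner_Integration.integral_diff[OF F integrable_mult_indicator[OF A F], symmetric],
              rule Bochner_Integration.integral_cong) (auto simp: indicator_def)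
        then show ?case using compl \<open>integral\<^sup>L lborel F = 0\<close> by simp
      next
        case (union A)
        then have A: "A i \<in> sets lborel" for i by (auto simp: borel_eq_box)
        have "(LINT x:(\<Union>i. A i)|lborel. F x) = (\<Sum>i. (LINT x:(A i)|lborel. F x))"
          using A union F integrable_mult_indicator[OF _ F, of "\<Union>i. A i"]
          by (intro lebesgue_integral_countable_add) (auto simp: disjoint_family_on_def set_integrable_def)
        then show ?case using union by simp
      qed
    qed
    have "AE x in lborel. F x = 0"
      by (rule density_unique_real[OF F]) (use FA in auto)
    \<comment> \<open>The integrals control the open box; its faces are null.\<close>
    moreover have "AE x in lborel. x \<notin> cbox a b - box a b"
      using negligible_frontier_interval[of a b]
      by (intro AE_not_in) (auto simp: negligible_iff_null_sets null_sets_completion_iff)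
    ultimately show ?thesis
      by eventually_elim (auto simp: F_def)
  qed
  obtain \<D> where "countable \<D>" "\<D> \<subseteq> Pow S" "\<And>X. X \<in> \<D> \<Longrightarrow> \<exists>a b. X = cbox a b" "\<Union>\<D> = S"
    using open_countable_Union_open_cbox[OF \<open>open S\<close>] by metis
  then have "AE x in lborel. \<forall>X\<in>\<D>. x \<in> X \<longrightarrow> H x = 0"
    using * by (subst AE_ball_countable) (auto, metis Sup_upper)
  then show ?thesis using \<open>\<Union>\<D> = S\<close> by (auto elim: eventually_mono)
qed

section \<open>Convexity of powers and Jensen's inequality\<close>

lemma powr_convex_nonneg:
  fixes s t u v q :: real
  assumes "0 \<le> s" "0 \<le> t" "0 \<le> u" "0 \<le> v" "u + v = 1" "1 \<le> q"
  shows "(u * s + v * t) powr q \<le> u * s powr q + v * t powr q"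
proof -
  \<comment> \<open>Convexity is available on the open half-line. If an argument is 0, the claim
    reduces to (w r)^q <= w r^q for a weight w in [0,1].\<close>
  have le: "w powr q \<le> w" if "0 \<le> w" "w \<le> 1" for w
    using that powr_mono'[of 1 q w] \<open>1 \<le> q\<close> by (cases "w = 0") auto
  have z: "(w * r) powr q \<le> w * r powr q" if "0 \<le> w" "w \<le> 1" "0 \<le> r" for w r
    using le[OF that(1,2)] that by (simp add: powr_mult mult_right_mono)
  have "convex_on {0<..} (\<lambda>x::real. x powr q)" using powr_convex assms by blast
  then show ?thesis
    using z[of u s] z[of v t] assms
    by (cases "s = 0"; cases "t = 0") (auto simp: convex_on_def)
qed

lemma convex_on_abs_powr:
  assumes "1 \<le> (q::real)"
  shows "convex_on UNIV (\<lambda>x::real. \<bar>x\<bar> powr q)"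
  unfolding convex_on_def
proof (intro conjI ballI allI impI)
  fix x y u v :: real
  assume uv: "0 \<le> u" "0 \<le> v" "u + v = 1"
  have "\<bar>u *\<^sub>R x + v *\<^sub>R y\<bar> powr q \<le> (u * \<bar>x\<bar> + v * \<bar>y\<bar>) powr q"
    using uv assms abs_triangle_ineq[of "u * x" "v * y"] by (intro powr_mono2) (auto simp: abs_mult)
  also have "\<dots> \<le> u * \<bar>x\<bar> powr q + v * \<bar>y\<bar> powr q"
    using uv assms by (intro powr_convex_nonneg) auto
  finally show "\<bar>u *\<^sub>R x + v *\<^sub>R y\<bar> powr q \<le> u * \<bar>x\<bar> powr q + v * \<bar>y\<bar> powr q" .
qed simp

lemma powr_norm_add_le:
  assumes "1 \<le> (q::real)"
  shows "norm (x + y) powr q \<le> 2 powr q * (norm x powr q + norm y powr q)"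
proof -
  have "norm (x + y) powr q \<le> (norm x + norm y) powr q"
    using assms by (intro powr_mono2) (auto simp: norm_triangle_ineq)
  also have "\<dots> = 2 powr q * (1/2 * norm x + 1/2 * norm y) powr q"
    by (subst powr_mult[symmetric]) (auto simp: algebra_simps)
  also have "\<dots> \<le> 2 powr q * (1/2 * norm x powr q + 1/2 * norm y powr q)"
    using assms by (intro mult_left_mono powr_convex_nonneg) auto
  also have "\<dots> \<le> 2 powr q * (norm x powr q + norm y powr q)"
    by (intro mult_left_mono add_mono) auto
  finally show ?thesis .
qed

text \<open>For a non-integrable \<open>u\<close> the left-hand side is \<open>0\<close>, the junk value of the Bochner integral.\<close>
lemma (in prob_space) abs_integral_powr_le_nn_integral:
  fixes u :: "'a \<Rightarrow> real"
  assumes [measurable]: "u \<in> borel_measurable M" and "1 \<le> q"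
  shows "ennreal (\<bar>integral\<^sup>L M u\<bar> powr q) \<le> (\<integral>\<^sup>+x. ennreal (\<bar>u x\<bar> powr q) \<partial>M)"
proof (cases "integrable M u \<and> (\<integral>\<^sup>+x. ennreal (\<bar>u x\<bar> powr q) \<partial>M) < \<infinity>")
  case True
  then have int: "integrable M (\<lambda>x. \<bar>u x\<bar> powr q)"
    by (intro integrableI_nonneg) auto
  have "\<bar>integral\<^sup>L M u\<bar> powr q \<le> integral\<^sup>L M (\<lambda>x. \<bar>u x\<bar> powr q)"
    using True int convex_on_abs_powr[OF \<open>1 \<le> q\<close>]
    by (intro jensens_inequality[where I=UNIV]) auto
  then show ?thesis using int by (simp add: nn_integral_eq_integral ennreal_leI)
qed (use not_integrable_integral_eq[of M u] in \<open>auto simp: not_less top_unique\<close>)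

text \<open>Encoded as a density so that the sigma-algebra is that of all reals: measurability on
  products and Fubini with \<open>lborel\<close> then involve no restricted spaces, while total mass
  1 makes Jensen's inequality applicable.\<close>

definition unit_interval_measure :: "real measure" where
  "unit_interval_measure = density lborel (\<lambda>s. ennreal (indicator {0..1} s))"

lemma sets_unit_interval_measure [simp, measurable_cong]: "sets unit_interval_measure = sets borel"
  by (simp add: unit_interval_measure_def)

lemma space_unit_interval_measure [simp]: "space unit_interval_measure = UNIV"
  by (simp add: unit_interval_measure_def)

interpretation unit_interval: prob_space unit_interval_measure
  by (rule prob_spaceI) (simp add: unit_interval_measure_def emeasure_density ennreal_indicator)

lemma AE_unit_interval_measure: "AE s in unit_interval_measure. 0 \<le> s \<and> s \<le> 1"
  unfolding unit_interval_measure_def by (subst AE_density) (auto simp: indicator_def)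

lemma integral_unit_interval_measure:
  fixes h :: "real \<Rightarrow> real"
  assumes "h \<in> borel_measurable borel"
  shows "integral\<^sup>L unit_interval_measure h = (\<integral>s. h s * indicator {0..1} s \<partial>lborel)"
  unfolding unit_interval_measure_def
  using assms by (subst integral_density) (auto simp: mult.commute)

interpretation unit_interval_lborel: pair_sigma_finite unit_interval_measure "lborel :: 'a::euclidean_space measure"
  by unfold_locales

interpretation lborel_unit_interval: pair_sigma_finite "lborel :: 'a::euclidean_space measure" unit_interval_measure
  by unfold_locales

section \<open>Translation invariance of Lebesgue integrals\<close>

lemma nn_integral_lborel_translate:
  fixes f :: "'a::euclidean_space \<Rightarrow> ennreal"
  assumes [measurable]: "f \<in> borel_measurable borel"
  shows "(\<integral>\<^sup>+x. f (x + v) \<partial>lborel) = (\<integral>\<^sup>+x. f x \<partial>lborel)"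
  by (subst (2) lborel_distr_plus[of v, symmetric])
     (simp add: nn_integral_distr add.commute)

lemma integral_lborel_translate:
  fixes f :: "'a::euclidean_space \<Rightarrow> real"
  assumes [measurable]: "f \<in> borel_measurable borel"
  shows "(\<integral>x. f (x + v) \<partial>lborel) = (\<integral>x. f x \<partial>lborel)"
  by (subst (2) lborel_distr_plus[of v, symmetric])
     (simp add: integral_distr add.commute)

lemma integrable_lborel_translate:
  fixes f :: "'a::euclidean_space \<Rightarrow> 'b::{banach, second_countable_topology}"
  assumes "integrable lborel f"
  shows "integrable lborel (\<lambda>x. f (x + v))"
proof -
  have "integrable (distr lborel borel ((+) v)) f" using assms by (simp add: lborel_distr_plus)
  then show ?thesis by (subst (asm) integrable_distr_eq) (use assms in \<open>auto simp: add.commute\<close>)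
qed

text \<open>A bound on the \<open>q\<close>-th power of the Morrey norm. Centres range over the
  whole space, which makes the notion stable under translation, and the extended integral spares
  integrability conditions.\<close>

definition morrey_le :: "real \<Rightarrow> real \<Rightarrow> 'a::euclidean_space set \<Rightarrow> ('a \<Rightarrow> 'b::real_normed_vector) \<Rightarrow> real \<Rightarrow> bool" where
  "morrey_le q lam A f K \<longleftrightarrow> (\<forall>x. \<forall>R>0.
     (\<integral>\<^sup>+y. ennreal (norm (f y) powr q) * indicator (A \<inter> ball x R) y \<partial>lborel) \<le> ennreal (K * R powr lam))"

lemma morrey_leD:
  "morrey_le q lam A f K \<Longrightarrow> R > 0 \<Longrightarrow>
    (\<integral>\<^sup>+y. ennreal (norm (f y) powr q) * indicator (A \<inter> ball x R) y \<partial>lborel) \<le> ennreal (K * R powr lam)"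
  by (simp add: morrey_le_def)

text \<open>Enlarging the constant, shrinking the set and dominating almost everywhere are joined
  because most uses combine them; a change of sign is an instance too.\<close>

lemma morrey_le_mono:
  assumes "morrey_le q lam B f K" "K \<le> K'" "0 \<le> q"
    and "AE x in lborel. x \<in> A \<longrightarrow> x \<in> B \<and> norm (f' x) \<le> norm (f x)"
  shows "morrey_le q lam A f' K'"
  unfolding morrey_le_def
proof (intro allI impI)
  fix x and R :: real assume "R > 0"
  have "(\<integral>\<^sup>+y. ennreal (norm (f' y) powr q) * indicator (A \<inter> ball x R) y \<partial>lborel)
     \<le> (\<integral>\<^sup>+y. ennreal (norm (f y) powr q) * indicator (B \<inter> ball x R) y \<partial>lborel)"
    by (rule nn_integral_mono_AE, use assms(4) in eventually_elim)
       (use assms(3) in \<open>auto simp: indicator_def intro!: ennreal_leI powr_mono2\<close>)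
  also have "\<dots> \<le> ennreal (K * R powr lam)" using assms(1) \<open>R > 0\<close> by (rule morrey_leD)
  also have "\<dots> \<le> ennreal (K' * R powr lam)" using assms(2) by (intro ennreal_leI mult_right_mono) auto
  finally show "(\<integral>\<^sup>+y. ennreal (norm (f' y) powr q) * indicator (A \<inter> ball x R) y \<partial>lborel)
    \<le> ennreal (K' * R powr lam)" .
qed

lemma morrey_le_add:
  assumes [measurable]: "f \<in> borel_measurable borel" "g \<in> borel_measurable borel" "A \<in> sets borel"
    and "morrey_le q lam A f K" "morrey_le q lam A g L" "1 \<le> q" "0 \<le> K" "0 \<le> L"
  shows "morrey_le q lam A (\<lambda>x. f x + g x) (2 powr q * (K + L))"
  unfolding morrey_le_def
proof (intro allI impI)
  fix x and R :: real assume "R > 0"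
  let ?i = "indicator (A \<inter> ball x R) :: 'a \<Rightarrow> ennreal"
  have "(\<integral>\<^sup>+y. ennreal (norm (f y + g y) powr q) * ?i y \<partial>lborel)
     \<le> (\<integral>\<^sup>+y. ennreal (2 powr q) * (ennreal (norm (f y) powr q) * ?i y + ennreal (norm (g y) powr q) * ?i y) \<partial>lborel)"
    using powr_norm_add_le[OF \<open>1 \<le> q\<close>]
    by (intro nn_integral_mono) (auto simp: indicator_def ennreal_mult[symmetric] ennreal_plus[symmetric] simp del: ennreal_plus intro!: ennreal_leI)
  also have "\<dots> = ennreal (2 powr q) * ((\<integral>\<^sup>+y. ennreal (norm (f y) powr q) * ?i y \<partial>lborel)
     + (\<integral>\<^sup>+y. ennreal (norm (g y) powr q) * ?i y \<partial>lborel))"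
    by (simp add: nn_integral_cmult nn_integral_add)
  also have "\<dots> \<le> ennreal (2 powr q) * (ennreal (K * R powr lam) + ennreal (L * R powr lam))"
    using assms(4,5) \<open>R > 0\<close> by (intro mult_left_mono add_mono morrey_leD) auto
  also have "\<dots> = ennreal (2 powr q * (K + L) * R powr lam)"
    using assms(7,8) by (simp add: ennreal_mult[symmetric] ennreal_plus[symmetric] algebra_simps del: ennreal_plus)
  finally show "(\<integral>\<^sup>+y. ennreal (norm (f y + g y) powr q) * ?i y \<partial>lborel)
    \<le> ennreal (2 powr q * (K + L) * R powr lam)" .
qed

lemma morrey_le_Un:
  assumes [measurable]: "f \<in> borel_measurable borel" "A \<in> sets borel" "B \<in> sets borel"
    and "morrey_le q lam A f K" "morrey_le q lam B f L" "0 \<le> K" "0 \<le> L"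
  shows "morrey_le q lam (A \<union> B) f (K + L)"
  unfolding morrey_le_def
proof (intro allI impI)
  fix x and R :: real assume "R > 0"
  have "(\<integral>\<^sup>+y. ennreal (norm (f y) powr q) * indicator ((A \<union> B) \<inter> ball x R) y \<partial>lborel)
     \<le> (\<integral>\<^sup>+y. ennreal (norm (f y) powr q) * indicator (A \<inter> ball x R) y
          + ennreal (norm (f y) powr q) * indicator (B \<inter> ball x R) y \<partial>lborel)"
    by (intro nn_integral_mono) (auto simp: indicator_def)
  also have "\<dots> = (\<integral>\<^sup>+y. ennreal (norm (f y) powr q) * indicator (A \<inter> ball x R) y \<partial>lborel)
     + (\<integral>\<^sup>+y. ennreal (norm (f y) powr q) * indicator (B \<inter> ball x R) y \<partial>lborel)"
    by (simp add: nn_integral_add)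
  also have "\<dots> \<le> ennreal (K * R powr lam) + ennreal (L * R powr lam)"
    using assms(4,5) \<open>R > 0\<close> by (intro add_mono morrey_leD) auto
  also have "\<dots> = ennreal ((K + L) * R powr lam)"
    using assms(6,7) by (simp add: ennreal_plus[symmetric] algebra_simps del: ennreal_plus)
  finally show "(\<integral>\<^sup>+y. ennreal (norm (f y) powr q) * indicator ((A \<union> B) \<inter> ball x R) y \<partial>lborel)
    \<le> ennreal ((K + L) * R powr lam)" .
qed

text \<open>For \<open>R \<ge> 1\<close> the total volume suffices, as
  \<open>R powr lam \<ge> 1\<close>. Below 1 the ball has volume R^n times that of the unit ball,
  and R^n <= R^lam because lam <= n. Thus constants have finite Morrey bounds on
  \<open>\<Omega>\<close>.\<close>

lemma bounded_measure_ball_le: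
  fixes \<Omega> :: "'a::euclidean_space set"
  assumes "bounded \<Omega>" "\<Omega> \<in> sets borel" "0 \<le> lam" "lam \<le> real DIM('a)"
  obtains M where "M > 0" "\<And>x R. R > 0 \<Longrightarrow> emeasure lborel (\<Omega> \<inter> ball x R) \<le> ennreal (M * R powr lam)"
proof
  let ?b = "measure lborel (ball (0::'a) 1)"
  let ?M = "measure lborel \<Omega> + ?b"
  have b: "?b > 0" using content_ball_pos[of 1 "0::'a"] by simp
  then show "?M > 0" by (simp add: add_nonneg_pos)
  fix x :: 'a and R :: real assume R: "R > 0"
  show "emeasure lborel (\<Omega> \<inter> ball x R) \<le> ennreal (?M * R powr lam)"
  proof (cases "R \<ge> 1")
    case True
    have "emeasure lborel (\<Omega> \<inter> ball x R) \<le> emeasure lborel \<Omega>"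
      using assms by (intro emeasure_mono) auto
    also have "\<dots> = ennreal (measure lborel \<Omega>)"
      using emeasure_bounded_finite[OF assms(1)] by (intro emeasure_eq_ennreal_measure) auto
    also have "measure lborel \<Omega> \<le> ?M * R powr lam"
      using mult_mono[of "measure lborel \<Omega>" ?M 1 "R powr lam"] True b assms
      by (simp add: ge_one_powr_ge_zero)
    finally show ?thesis by (simp add: ennreal_leI)
  next
    case False
    have "emeasure lborel (\<Omega> \<inter> ball x R) \<le> emeasure lborel (ball x R)"
      by (intro emeasure_mono) auto
    also have "\<dots> = ennreal (measure lborel (ball x R))"
      using emeasure_bounded_finite[of "ball x R"] by (subst emeasure_eq_ennreal_measure) auto
    also have "measure lborel (ball x R) = R powr real DIM('a) * ?b"
      using R by (subst content_ball_conv_unit_ball) (auto simp: powr_realpow)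
    also have "\<dots> \<le> R powr lam * ?M"
      using R False assms b by (intro mult_mono powr_mono') auto
    finally show ?thesis by (simp add: ennreal_leI mult.commute)
  qed
qed

lemma morrey_le_const:
  assumes "\<And>x R. R > 0 \<Longrightarrow> emeasure lborel (\<Omega> \<inter> ball x R) \<le> ennreal (M * R powr lam)"
    and "\<Omega> \<in> sets borel" "0 < M"
  shows "morrey_le q lam \<Omega> (\<lambda>_. c) (norm c powr q * M)"
  unfolding morrey_le_def
proof (intro allI impI)
  fix x and R :: real assume "R > 0"
  have "(\<integral>\<^sup>+y. ennreal (norm c powr q) * indicator (\<Omega> \<inter> ball x R) y \<partial>lborel)
      = ennreal (norm c powr q) * emeasure lborel (\<Omega> \<inter> ball x R)"
    using assms by (subst nn_integral_cmult_indicator) auto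
  also have "\<dots> \<le> ennreal (norm c powr q) * ennreal (M * R powr lam)"
    using assms \<open>R > 0\<close> by (intro mult_left_mono) auto
  finally show "(\<integral>\<^sup>+y. ennreal (norm c powr q) * indicator (\<Omega> \<inter> ball x R) y \<partial>lborel)
    \<le> ennreal (norm c powr q * M * R powr lam)"
    using assms by (simp add: ennreal_mult[symmetric] mult.assoc)
qed

text \<open>The segments may leave \<open>S\<close>, so \<open>g\<close> is bounded on the whole
  space: for fixed \<open>s\<close> the ball around \<open>x0\<close> turns into one of the same
  radius around \<open>x0\<close> shifted by s v. The factor \<open>norm v powr q\<close> comes from
  Cauchy-Schwarz.\<close>

lemma morrey_le_line_integral:
  fixes g :: "'a::euclidean_space \<Rightarrow> 'a"
  assumes [measurable]: "g \<in> borel_measurable borel"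
    and F: "AE x in lborel. x \<in> S \<longrightarrow> F x = (\<integral>s. g (x + s *\<^sub>R v) \<bullet> v \<partial>unit_interval_measure)"
    and g: "morrey_le q lam UNIV g K" and "1 \<le> q" "0 \<le> K"
  shows "morrey_le q lam S (F :: 'a \<Rightarrow> real) (norm v powr q * K)"
  unfolding morrey_le_def
proof (intro allI impI)
  fix x0 and R :: real assume R: "R > 0"
  let ?G = "\<lambda>x s. ennreal (norm (g (x + s *\<^sub>R v)) powr q)"
  have "(\<integral>\<^sup>+x. ennreal (norm (F x) powr q) * indicator (S \<inter> ball x0 R) x \<partial>lborel)
    \<le> (\<integral>\<^sup>+x. (\<integral>\<^sup>+s. ennreal (norm v powr q) * (?G x s * indicator (ball x0 R) x) \<partial>unit_interval_measure) \<partial>lborel)"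
  proof (rule nn_integral_mono_AE, use F in eventually_elim)
    case (elim x)
    show ?case
    proof (cases "x \<in> S \<inter> ball x0 R")
      case True
      have "ennreal (\<bar>F x\<bar> powr q) \<le> (\<integral>\<^sup>+s. ennreal (\<bar>g (x + s *\<^sub>R v) \<bullet> v\<bar> powr q) \<partial>unit_interval_measure)"
        using elim True \<open>1 \<le> q\<close> unit_interval.abs_integral_powr_le_nn_integral[of "\<lambda>s. g (x + s *\<^sub>R v) \<bullet> v" q] by simp
      also have "\<dots> \<le> (\<integral>\<^sup>+s. ennreal (norm v powr q) * ?G x s \<partial>unit_interval_measure)"
      proof (rule nn_integral_mono)
        fix s
        have "\<bar>g (x + s *\<^sub>R v) \<bullet> v\<bar> powr q \<le> (norm v * norm (g (x + s *\<^sub>R v))) powr q"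
          using \<open>1 \<le> q\<close> Cauchy_Schwarz_ineq2[of "g (x + s *\<^sub>R v)" v] by (intro powr_mono2) (auto simp: mult.commute)
        then show "ennreal (\<bar>g (x + s *\<^sub>R v) \<bullet> v\<bar> powr q) \<le> ennreal (norm v powr q) * ?G x s"
          by (simp add: ennreal_mult[symmetric] powr_mult ennreal_leI)
      qed
      finally show ?thesis using True by simp
    qed simp
  qed
  \<comment> \<open>The Morrey bound applies to one translate of \<open>g\<close> at a time, so the
    integration in \<open>x\<close> has to become the inner one.\<close>
  also have "\<dots> = (\<integral>\<^sup>+s. (\<integral>\<^sup>+x. ennreal (norm v powr q) * (?G x s * indicator (ball x0 R) x) \<partial>lborel) \<partial>unit_interval_measure)"
    by (rule lborel_unit_interval.Fubini'[symmetric]) measurable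
  also have "\<dots> \<le> (\<integral>\<^sup>+s. ennreal (norm v powr q * K * R powr lam) \<partial>unit_interval_measure)"
  proof (rule nn_integral_mono)
    fix s :: real
    have "(\<integral>\<^sup>+x. ennreal (norm v powr q) * (?G x s * indicator (ball x0 R) x) \<partial>lborel)
      = ennreal (norm v powr q) * (\<integral>\<^sup>+x. ?G x s * indicator (ball x0 R) x \<partial>lborel)"
      by (subst nn_integral_cmult) auto
    also have "(\<integral>\<^sup>+x. ?G x s * indicator (ball x0 R) x \<partial>lborel)
      = (\<integral>\<^sup>+x. ?G x s * indicator (UNIV \<inter> ball (x0 + s *\<^sub>R v) R) (x + s *\<^sub>R v) \<partial>lborel)"
      by (intro nn_integral_cong) (auto simp: indicator_def)
    also have "\<dots> = (\<integral>\<^sup>+y. ennreal (norm (g y) powr q) * indicator (UNIV \<inter> ball (x0 + s *\<^sub>R v) R) y \<partial>lborel)"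
      by (rule nn_integral_lborel_translate[where f="\<lambda>y. ennreal (norm (g y) powr q) * indicator (UNIV \<inter> ball (x0 + s *\<^sub>R v) R) y"]) measurable
    also have "\<dots> \<le> ennreal (K * R powr lam)" using g R by (rule morrey_leD)
    finally show "(\<integral>\<^sup>+x. ennreal (norm v powr q) * (?G x s * indicator (ball x0 R) x) \<partial>lborel)
      \<le> ennreal (norm v powr q * K * R powr lam)"
      using \<open>0 \<le> K\<close> by (simp add: ennreal_mult mult_left_mono mult.assoc)
  qed
  also have "\<dots> = ennreal (norm v powr q * K * R powr lam)"
    using unit_interval.emeasure_space_1 by simp
  finally show "(\<integral>\<^sup>+x. ennreal (norm (F x) powr q) * indicator (S \<inter> ball x0 R) x \<partial>lborel)
    \<le> ennreal (norm v powr q * K * R powr lam)" .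
qed

subsection \<open>Translating weakly differentiable functions\<close>

lemma smooth_imp_differentiable: "smooth \<phi> \<Longrightarrow> \<phi> differentiable (at x)"
  unfolding smooth_def using Ck.simps(2)[of 0 \<phi>] by blast

lemma smooth_imp_continuous: "smooth \<phi> \<Longrightarrow> continuous_on UNIV \<phi>"
  unfolding smooth_def using Ck_imp_continuous by blast

lemma frechet_derivative_componentwise:
  fixes \<phi> :: "'a::euclidean_space \<Rightarrow> real"
  assumes "\<phi> differentiable (at x)"
  shows "frechet_derivative \<phi> (at x) v = (\<Sum>i\<in>Basis. (v \<bullet> i) * frechet_derivative \<phi> (at x) i)"
proof -
  have "linear (frechet_derivative \<phi> (at x))" using assms by (rule linear_frechet_derivative)
  then show ?thesis
    by (subst euclidean_representation[of v, symmetric]) (simp add: linear_sum linear_cmul)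
qed

lemma grad_inner:
  assumes "\<phi> differentiable (at x)"
  shows "grad \<phi> x \<bullet> v = frechet_derivative \<phi> (at x) v"
  unfolding grad_def frechet_derivative_componentwise[OF assms, of v]
  by (simp add: inner_sum_left inner_commute[of v] mult.commute)

lemma continuous_frechet_derivative:
  fixes \<phi> :: "'a::euclidean_space \<Rightarrow> real"
  assumes "smooth \<phi>"
  shows "continuous_on UNIV (\<lambda>x. frechet_derivative \<phi> (at x) v)"
proof -
  have "Ck (Suc 0) \<phi>" using assms unfolding smooth_def by blast
  then have "continuous_on UNIV (\<lambda>x. frechet_derivative \<phi> (at x) i)" if "i \<in> Basis" for i
    using that by simp
  then show ?thesis
    unfolding frechet_derivative_componentwise[OF smooth_imp_differentiable[OF assms], of _ v]
    by (intro continuous_intros) auto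
qed

lemma frechet_derivative_outside_tsupport:
  fixes \<phi> :: "'a::euclidean_space \<Rightarrow> real"
  assumes "x \<notin> tsupport \<phi>"
  shows "frechet_derivative \<phi> (at x) v = 0"
proof -
  have "(\<phi> has_derivative (\<lambda>_. 0)) (at x)"
  proof (rule has_derivative_transform_within_open)
    show "((\<lambda>_. 0::real) has_derivative (\<lambda>_. 0)) (at x)" by simp
    show "open (- tsupport \<phi>)" by (simp add: tsupport_def open_Compl)
    show "x \<in> - tsupport \<phi>" using assms by simp
    show "0 = \<phi> y" if "y \<in> - tsupport \<phi>" for y
      using that closure_subset[of "{x. \<phi> x \<noteq> 0}"] unfolding tsupport_def by auto
  qed
  then show ?thesis using frechet_derivative_at by metis
qed

lemma bounded_if_continuous_zero_outside_compact:
  fixes h :: "'a::euclidean_space \<Rightarrow> real"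
  assumes "continuous_on UNIV h" "compact K" "\<And>x. x \<notin> K \<Longrightarrow> h x = 0"
  obtains B where "\<And>x. \<bar>h x\<bar> \<le> B"
proof -
  have "bounded (h ` K)"
    using assms by (intro compact_imp_bounded compact_continuous_image) (auto intro: continuous_on_subset)
  then obtain B where "\<And>x. x \<in> K \<Longrightarrow> \<bar>h x\<bar> \<le> B" by (auto simp: bounded_iff)
  then have "\<bar>h x\<bar> \<le> max B 0" for x using assms(3)[of x] by (cases "x \<in> K") (auto simp: le_max_iff_disj)
  then show ?thesis by (rule that)
qed

lemma integrable_mult_bounded:
  fixes f h :: "'a \<Rightarrow> real"
  assumes "integrable M f" "h \<in> borel_measurable M" "\<And>x. \<bar>h x\<bar> \<le> B"
  shows "integrable M (\<lambda>x. f x * h x)"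
proof (rule Bochner_Integration.integrable_bound)
  show "integrable M (\<lambda>x. f x * B)" using assms by simp
  show "AE x in M. norm (f x * h x) \<le> norm (f x * B)"
  proof (rule AE_I2)
    fix x show "norm (f x * h x) \<le> norm (f x * B)"
      using assms(3)[of x] by (auto simp: abs_mult intro!: mult_left_mono)
  qed
  show "(\<lambda>x. f x * h x) \<in> borel_measurable M" using assms by measurable
qed

lemma fundamental_theorem_segment:
  fixes \<phi> :: "'a::euclidean_space \<Rightarrow> real"
  assumes "smooth \<phi>"
  shows "\<phi> (x + v) - \<phi> x = (\<integral>s. frechet_derivative \<phi> (at (x + s *\<^sub>R v)) v \<partial>unit_interval_measure)"
proof -
  have cont': "continuous_on UNIV (\<lambda>s. frechet_derivative \<phi> (at (x + s *\<^sub>R v)) v)"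
    by (rule continuous_on_compose2[OF continuous_frechet_derivative[OF assms]]) (auto intro!: continuous_intros)
  then have cont: "isCont (\<lambda>s. frechet_derivative \<phi> (at (x + s *\<^sub>R v)) v) s" for s
    by (simp add: continuous_on_eq_continuous_at)
  have der: "((\<lambda>s. \<phi> (x + s *\<^sub>R v)) has_real_derivative frechet_derivative \<phi> (at (x + s *\<^sub>R v)) v) (at s)" for s
  proof -
    have D: "(\<phi> has_derivative frechet_derivative \<phi> (at (x + s *\<^sub>R v))) (at (x + s *\<^sub>R v))"
      using smooth_imp_differentiable[OF assms] frechet_derivative_works by blast
    then have "linear (frechet_derivative \<phi> (at (x + s *\<^sub>R v)))" by (rule has_derivative_linear)
    then have "frechet_derivative \<phi> (at (x + s *\<^sub>R v)) (r *\<^sub>R v) = frechet_derivative \<phi> (at (x + s *\<^sub>R v)) v * r" for r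
      by (simp add: linear_cmul)
    moreover have "((\<lambda>s. \<phi> (x + s *\<^sub>R v)) has_derivative (\<lambda>r. frechet_derivative \<phi> (at (x + s *\<^sub>R v)) (r *\<^sub>R v))) (at s)"
      by (rule has_derivative_compose[of "\<lambda>s. x + s *\<^sub>R v" "\<lambda>r. r *\<^sub>R v" s UNIV \<phi>, OF _ D])
         (auto intro!: derivative_eq_intros)
    ultimately show ?thesis by (simp add: has_field_derivative_def)
  qed
  have "(\<integral>s. frechet_derivative \<phi> (at (x + s *\<^sub>R v)) v * indicator {0..1} s \<partial>lborel)
    = \<phi> (x + 1 *\<^sub>R v) - \<phi> (x + 0 *\<^sub>R v)"
    by (rule integral_FTC_Icc_real[where F="\<lambda>s. \<phi> (x + s *\<^sub>R v)"]) (use cont der in auto)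
  moreover have "(\<lambda>s. frechet_derivative \<phi> (at (x + s *\<^sub>R v)) v) \<in> borel_measurable borel"
    by (rule borel_measurable_continuous_onI) (fact cont')
  ultimately show ?thesis by (simp add: integral_unit_interval_measure)
qed

text \<open>Every slice at fixed \<open>s\<close> has the same L^1 norm by translation invariance,
  and the measure in \<open>s\<close> has mass 1. This justifies the later exchanges of
  integrals.\<close>

lemma integrable_translates_product:
  fixes f :: "'a::euclidean_space \<Rightarrow> real"
  assumes f: "integrable lborel f"
  shows "integrable (unit_interval_measure \<Otimes>\<^sub>M lborel) (\<lambda>(s, x). f (x + s *\<^sub>R v))"
proof (rule integrableI_bounded)
  have [measurable]: "f \<in> borel_measurable borel" using borel_measurable_integrable[OF f] by simp
  show "(\<lambda>(s, x). f (x + s *\<^sub>R v)) \<in> borel_measurable (unit_interval_measure \<Otimes>\<^sub>M lborel)" by measurable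
  have "(\<integral>\<^sup>+z. ennreal (norm (case z of (s, x) \<Rightarrow> f (x + s *\<^sub>R v))) \<partial>(unit_interval_measure \<Otimes>\<^sub>M lborel))
    = (\<integral>\<^sup>+s. (\<integral>\<^sup>+x. ennreal (norm (f (x + s *\<^sub>R v))) \<partial>lborel) \<partial>unit_interval_measure)"
    by (subst lborel.nn_integral_fst[symmetric]) auto
  also have "\<dots> = (\<integral>\<^sup>+x. ennreal (norm (f x)) \<partial>lborel)"
    using unit_interval.emeasure_space_1
    by (simp add: nn_integral_lborel_translate[where f="\<lambda>x. ennreal \<bar>f x\<bar>"])
  also have "\<dots> < \<infinity>" using f by (simp add: integrable_iff_bounded)
  finally show "(\<integral>\<^sup>+z. ennreal (norm (case z of (s, x) \<Rightarrow> f (x + s *\<^sub>R v))) \<partial>(unit_interval_measure \<Otimes>\<^sub>M lborel)) < \<infinity>" .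
qed

text \<open>A weak gradient for functions integrable over the whole space, in practice extensions by
  zero from \<open>\<Omega>\<close>. Translates of \<open>f\<close> and \<open>g\<close> then make
  sense everywhere, and only the test functions remember \<open>\<Omega>\<close>.\<close>

definition weak_pair :: "'a::euclidean_space set \<Rightarrow> ('a \<Rightarrow> real) \<Rightarrow> ('a \<Rightarrow> 'a) \<Rightarrow> bool" where
  "weak_pair \<Omega> f g \<longleftrightarrow> integrable lborel f \<and> integrable lborel g \<and>
     (\<forall>\<phi>. C0inf \<Omega> \<phi> \<longrightarrow> (\<forall>i\<in>Basis.
        (\<integral>x. f x * frechet_derivative \<phi> (at x) i \<partial>lborel) = - (\<integral>x. (g x \<bullet> i) * \<phi> x \<partial>lborel)))"

lemma weak_pair_measurable:
  assumes "weak_pair \<Omega> f g"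
  shows "f \<in> borel_measurable borel" "g \<in> borel_measurable borel"
  using assms borel_measurable_integrable[of lborel f] borel_measurable_integrable[of lborel g]
  by (auto simp: weak_pair_def)

lemma C0inf_bounds:
  fixes \<phi> :: "'a::euclidean_space \<Rightarrow> real"
  assumes "C0inf \<Omega> \<phi>"
  obtains B where "\<And>x. \<bar>\<phi> x\<bar> \<le> B" "\<And>x. \<bar>frechet_derivative \<phi> (at x) v\<bar> \<le> B"
proof -
  have \<phi>: "smooth \<phi>" "compact (tsupport \<phi>)" using assms by (auto simp: C0inf_def)
  have zero: "\<phi> x = 0" if "x \<notin> tsupport \<phi>" for x
    using that closure_subset[of "{x. \<phi> x \<noteq> 0}"] unfolding tsupport_def by blast
  obtain B1 where B1: "\<And>x. \<bar>\<phi> x\<bar> \<le> B1"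
    using bounded_if_continuous_zero_outside_compact[OF smooth_imp_continuous[OF \<phi>(1)] \<phi>(2) zero] by blast
  obtain B2 where B2: "\<And>x. \<bar>frechet_derivative \<phi> (at x) v\<bar> \<le> B2"
    using bounded_if_continuous_zero_outside_compact[OF continuous_frechet_derivative[OF \<phi>(1), of v] \<phi>(2)
      frechet_derivative_outside_tsupport] by blast
  show ?thesis
    by (rule that[of "max B1 B2"]) (use B1 B2 in \<open>auto simp: le_max_iff_disj\<close>)
qed

lemma C0inf_measurable:
  fixes \<phi> :: "'a::euclidean_space \<Rightarrow> real"
  assumes "C0inf \<Omega> \<phi>"
  shows "\<phi> \<in> borel_measurable borel" "(\<lambda>x. frechet_derivative \<phi> (at x) v) \<in> borel_measurable borel"
  using assms continuous_frechet_derivative smooth_imp_continuous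
  by (auto simp: C0inf_def intro!: borel_measurable_continuous_onI)

text \<open>Translation vectors point in arbitrary directions; linearity of the derivative carries
  the identity over from the basis vectors.\<close>

lemma weak_pair_direction:
  assumes fg: "weak_pair \<Omega> f g" and \<phi>: "C0inf \<Omega> \<phi>"
  shows "(\<integral>x. f x * frechet_derivative \<phi> (at x) v \<partial>lborel) = - (\<integral>x. (g x \<bullet> v) * \<phi> x \<partial>lborel)"
proof -
  have f: "integrable lborel f" and g: "integrable lborel g" using fg by (auto simp: weak_pair_def)
  have diff: "\<phi> differentiable (at x)" for x
    using \<phi> by (auto simp: C0inf_def intro: smooth_imp_differentiable)
  have intf: "integrable lborel (\<lambda>x. f x * frechet_derivative \<phi> (at x) i)" for i
  proof -
    obtain B where "\<And>x. \<bar>frechet_derivative \<phi> (at x) i\<bar> \<le> B" using C0inf_bounds[OF \<phi>] by metis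
    then show ?thesis using C0inf_measurable(2)[OF \<phi>] by (intro integrable_mult_bounded[OF f]) auto
  qed
  have intg: "integrable lborel (\<lambda>x. (g x \<bullet> i) * \<phi> x)" for i
  proof -
    obtain B where "\<And>x. \<bar>\<phi> x\<bar> \<le> B" using C0inf_bounds[OF \<phi>] by metis
    then show ?thesis using C0inf_measurable(1)[OF \<phi>] g by (intro integrable_mult_bounded) auto
  qed
  have "(\<integral>x. f x * frechet_derivative \<phi> (at x) v \<partial>lborel)
    = (\<integral>x. (\<Sum>i\<in>Basis. (v \<bullet> i) * (f x * frechet_derivative \<phi> (at x) i)) \<partial>lborel)"
    by (subst frechet_derivative_componentwise[OF diff]) (simp add: sum_distrib_left algebra_simps)
  also have "\<dots> = (\<Sum>i\<in>Basis. (v \<bullet> i) * (\<integral>x. f x * frechet_derivative \<phi> (at x) i \<partial>lborel))"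
    using intf by (subst Bochner_Integration.integral_sum) auto
  also have "\<dots> = - (\<Sum>i\<in>Basis. (v \<bullet> i) * (\<integral>x. (g x \<bullet> i) * \<phi> x \<partial>lborel))"
    using fg \<phi> by (simp add: weak_pair_def sum_negf)
  also have "(\<Sum>i\<in>Basis. (v \<bullet> i) * (\<integral>x. (g x \<bullet> i) * \<phi> x \<partial>lborel))
    = (\<integral>x. (\<Sum>i\<in>Basis. (v \<bullet> i) * ((g x \<bullet> i) * \<phi> x)) \<partial>lborel)"
    using intg by (subst Bochner_Integration.integral_sum) auto
  also have "\<dots> = (\<integral>x. (g x \<bullet> v) * \<phi> x \<partial>lborel)"
    by (subst (2) euclidean_inner) (simp add: sum_distrib_left algebra_simps)
  finally show ?thesis .
qed

lemma frechet_derivative_bump_translate: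
  "frechet_derivative (bump a b m) (at (x - w)) v = frechet_derivative (bump (a + w) (b + w) m) (at x) v"
proof -
  have "(bump a b m has_derivative frechet_derivative (bump a b m) (at (x - w))) (at (x - w))"
    using smooth_imp_differentiable[OF smooth_bump] frechet_derivative_works by blast
  then have "((\<lambda>x. bump a b m (x - w)) has_derivative frechet_derivative (bump a b m) (at (x - w))) (at x)"
    by (rule has_derivative_compose[of "\<lambda>x. x - w" "\<lambda>h. h" x UNIV "bump a b m", rotated])
       (auto intro!: derivative_eq_intros)
  then show ?thesis
    unfolding bump_translate using frechet_derivative_at by metis
qed

text \<open>A discrete integration by parts. The increment of \<open>f\<close> is shifted to the
  bump, whose own increment is the integral of its directional derivative. For each \<open>s\<close>
  the translated bump is an admissible test function, so the derivative passes to \<open>g\<close>,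
  and translating back restores the original bump.\<close>

lemma weak_pair_translate_test:
  fixes f :: "'a::euclidean_space \<Rightarrow> real"
  assumes fg: "weak_pair \<Omega> f g"
    and sub: "\<And>s. 0 \<le> s \<Longrightarrow> s \<le> 1 \<Longrightarrow> cbox (a + s *\<^sub>R v) (b + s *\<^sub>R v) \<subseteq> \<Omega>"
  shows "integrable lborel (\<lambda>x. \<integral>s. g (x + s *\<^sub>R v) \<bullet> v \<partial>unit_interval_measure)"
    and "(\<integral>x. (f (x + v) - f x - (\<integral>s. g (x + s *\<^sub>R v) \<bullet> v \<partial>unit_interval_measure)) * bump a b m x \<partial>lborel) = 0"
proof -
  let ?I = unit_interval_measure
  define \<psi> where "\<psi> = bump a b m"
  define D where "D x = frechet_derivative \<psi> (at x) v" for x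
  define G where "G x = (\<integral>s. g (x + s *\<^sub>R v) \<bullet> v \<partial>?I)" for x
  have f: "integrable lborel f" and g: "integrable lborel g" using fg by (auto simp: weak_pair_def)
  note [measurable] = weak_pair_measurable[OF fg]
  have \<psi>: "C0inf UNIV \<psi>" "smooth \<psi>" unfolding \<psi>_def by (auto intro: C0inf_bump smooth_bump)
  have [measurable]: "\<psi> \<in> borel_measurable borel" "D \<in> borel_measurable borel"
    using C0inf_measurable[OF \<psi>(1)] by (auto simp: D_def[abs_def])
  obtain B where B: "\<And>x. \<bar>\<psi> x\<bar> \<le> B" "\<And>x. \<bar>D x\<bar> \<le> B" unfolding D_def using C0inf_bounds[OF \<psi>(1)] by metis
  have gv: "integrable lborel (\<lambda>x. g x \<bullet> v)" using g by simp
  have prod_g: "integrable (?I \<Otimes>\<^sub>M lborel) (\<lambda>(s, x). g (x + s *\<^sub>R v) \<bullet> v)"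
    using integrable_translates_product[OF gv, of v] by simp
  have "integrable lborel G" unfolding G_def
    using unit_interval_lborel.integrable_snd[OF prod_g] by simp
  then show "integrable lborel (\<lambda>x. \<integral>s. g (x + s *\<^sub>R v) \<bullet> v \<partial>unit_interval_measure)"
    unfolding G_def .
  have i1: "integrable lborel (\<lambda>x. f (x + v) * \<psi> x)" and i2: "integrable lborel (\<lambda>x. f x * \<psi> x)"
    and i3: "integrable lborel (\<lambda>x. G x * \<psi> x)"
    using B integrable_lborel_translate[OF f] f \<open>integrable lborel G\<close>
    by (auto intro!: integrable_mult_bounded)
  have i4: "integrable lborel (\<lambda>y. f y * \<psi> (y - v))"
    using B f by (intro integrable_mult_bounded) auto
  have "(\<integral>x. f (x + v) * \<psi> x \<partial>lborel) = (\<integral>y. f y * \<psi> (y - v) \<partial>lborel)"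
    using integral_lborel_translate[of "\<lambda>y. f y * \<psi> (y - v)" v] by simp
  then have "(\<integral>x. f (x + v) * \<psi> x \<partial>lborel) - (\<integral>x. f x * \<psi> x \<partial>lborel)
    = (\<integral>y. f y * (\<psi> (y - v) - \<psi> y) \<partial>lborel)"
    using i4 i2 by (simp add: right_diff_distrib)
  also have "\<dots> = (\<integral>y. (\<integral>s. - (f y * D (y - s *\<^sub>R v)) \<partial>?I) \<partial>lborel)"
  proof (intro Bochner_Integration.integral_cong refl)
    fix y
    \<comment> \<open>The bump moves against \<open>f\<close>: the segment runs from y to y - v,
      which is the source of the minus sign.\<close>
    have "frechet_derivative \<psi> (at z) (- v) = - D z" for z
      unfolding D_def using linear_neg[OF linear_frechet_derivative[OF smooth_imp_differentiable[OF \<psi>(2)]]] by blast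
    then show "f y * (\<psi> (y - v) - \<psi> y) = (\<integral>s. - (f y * D (y - s *\<^sub>R v)) \<partial>?I)"
      using fundamental_theorem_segment[OF \<psi>(2), of y "- v"] by simp
  qed
  also have "\<dots> = (\<integral>s. (\<integral>y. - (f y * D (y - s *\<^sub>R v)) \<partial>lborel) \<partial>?I)"
  proof (rule unit_interval_lborel.Fubini_integral)
    \<comment> \<open>Translation by the vector 0 presents \<open>f\<close> itself as an integrable
      function on the product space.\<close>
    have "integrable (?I \<Otimes>\<^sub>M lborel) (\<lambda>z. (case z of (s, x) \<Rightarrow> f (x + s *\<^sub>R 0)) * (case z of (s, y) \<Rightarrow> - D (y - s *\<^sub>R v)))"
    proof (rule integrable_mult_bounded[OF integrable_translates_product[OF f]])
      show "\<bar>case z of (s, y) \<Rightarrow> - D (y - s *\<^sub>R v)\<bar> \<le> B" for z using B by (cases z) auto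
    qed measurable
    then show "integrable (?I \<Otimes>\<^sub>M lborel) (\<lambda>(s, y). - (f y * D (y - s *\<^sub>R v)))"
      by (simp add: case_prod_unfold)
  qed
  also have "\<dots> = (\<integral>s. (\<integral>x. (g (x + s *\<^sub>R v) \<bullet> v) * \<psi> x \<partial>lborel) \<partial>?I)"
  proof (rule integral_cong_AE, measurable, use AE_unit_interval_measure in eventually_elim)
    \<comment> \<open>The measure in \<open>s\<close> is a measure on the whole line, but the
      shifted box is known to lie in \<open>\<Omega>\<close> for s in [0,1], which is almost every
      \<open>s\<close>.\<close>
    fix s :: real assume "0 \<le> s \<and> s \<le> 1"
    then have "C0inf \<Omega> (bump (a + s *\<^sub>R v) (b + s *\<^sub>R v) m)"
      by (intro C0inf_bump sub) auto
    from weak_pair_direction[OF fg this, of v]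
    have "- (\<integral>y. f y * D (y - s *\<^sub>R v) \<partial>lborel) = (\<integral>y. (g y \<bullet> v) * \<psi> (y - s *\<^sub>R v) \<partial>lborel)"
      unfolding D_def \<psi>_def frechet_derivative_bump_translate bump_translate by simp
    also have "\<dots> = (\<integral>x. (g (x + s *\<^sub>R v) \<bullet> v) * \<psi> x \<partial>lborel)"
      using integral_lborel_translate[of "\<lambda>y. (g y \<bullet> v) * \<psi> (y - s *\<^sub>R v)" "s *\<^sub>R v"] by simp
    finally show "(\<integral>y. - (f y * D (y - s *\<^sub>R v)) \<partial>lborel) = (\<integral>x. (g (x + s *\<^sub>R v) \<bullet> v) * \<psi> x \<partial>lborel)"
      by simp
  qed
  also have "\<dots> = (\<integral>x. (\<integral>s. (g (x + s *\<^sub>R v) \<bullet> v) * \<psi> x \<partial>?I) \<partial>lborel)"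
  proof (rule unit_interval_lborel.Fubini_integral[symmetric])
    have "integrable (?I \<Otimes>\<^sub>M lborel) (\<lambda>z. (case z of (s, x) \<Rightarrow> g (x + s *\<^sub>R v) \<bullet> v) * (case z of (s, x) \<Rightarrow> \<psi> x))"
    proof (rule integrable_mult_bounded[OF prod_g])
      show "\<bar>case z of (s, x) \<Rightarrow> \<psi> x\<bar> \<le> B" for z using B by (cases z) auto
    qed measurable
    then show "integrable (?I \<Otimes>\<^sub>M lborel) (\<lambda>(s, x). (g (x + s *\<^sub>R v) \<bullet> v) * \<psi> x)"
      by (simp add: case_prod_unfold)
  qed
  also have "\<dots> = (\<integral>x. G x * \<psi> x \<partial>lborel)"
    unfolding G_def by (simp add: integral_mult_left_zero)
  finally show "(\<integral>x. (f (x + v) - f x - (\<integral>s. g (x + s *\<^sub>R v) \<bullet> v \<partial>?I)) * bump a b m x \<partial>lborel) = 0"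
    using i1 i2 i3 unfolding G_def[symmetric] \<psi>_def[symmetric] by (simp add: left_diff_distrib)
qed

text \<open>In the tested identity the bumps converge to the indicator of a box, with the absolute
  value of the defect \<open>H\<close> as majorant. Hence \<open>H\<close> has integral 0 over every
  box with closure in \<open>S\<close>.\<close>

lemma weak_pair_translate_AE:
  fixes f :: "'a::euclidean_space \<Rightarrow> real"
  assumes fg: "weak_pair \<Omega> f g" and "open S"
    and sub: "\<And>x s. x \<in> S \<Longrightarrow> 0 \<le> s \<Longrightarrow> s \<le> 1 \<Longrightarrow> x + s *\<^sub>R v \<in> \<Omega>"
  shows "AE x in lborel. x \<in> S \<longrightarrow> f (x + v) - f x = (\<integral>s. g (x + s *\<^sub>R v) \<bullet> v \<partial>unit_interval_measure)"
proof (cases "S = {}")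
  case False
  define H where "H x = f (x + v) - f x - (\<integral>s. g (x + s *\<^sub>R v) \<bullet> v \<partial>unit_interval_measure)" for x
  have cb: "cbox (a + s *\<^sub>R v) (b + s *\<^sub>R v) \<subseteq> \<Omega>" if "cbox a b \<subseteq> S" "0 \<le> s" "s \<le> 1" for a b s
  proof
    fix y assume "y \<in> cbox (a + s *\<^sub>R v) (b + s *\<^sub>R v)"
    then have "y - s *\<^sub>R v \<in> cbox a b" by (auto simp: mem_box algebra_simps)
    then show "y \<in> \<Omega>" using sub[of "y - s *\<^sub>R v" s] that by auto
  qed
  obtain x0 where "x0 \<in> S" using False by auto
  \<comment> \<open>The integrability statement is phrased relative to a box; a one-point box
    serves.\<close>
  then have "cbox x0 x0 \<subseteq> S" by simp
  then have "integrable lborel (\<lambda>x. \<integral>s. g (x + s *\<^sub>R v) \<bullet> v \<partial>unit_interval_measure)"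
    using weak_pair_translate_test(1)[OF fg, of x0 v x0] cb by blast
  then have H: "integrable lborel H"
    using fg integrable_lborel_translate[of f v] unfolding H_def weak_pair_def by auto
  have "AE x in lborel. x \<in> S \<longrightarrow> H x = 0"
  proof (rule box_integrals_zero_imp_AE_zero[OF \<open>open S\<close> H])
    fix a b assume ab: "cbox a b \<subseteq> S"
    have zero: "(\<integral>x. H x * bump a b m x \<partial>lborel) = 0" for m
      unfolding H_def using weak_pair_translate_test(2)[OF fg, of a v b m] cb[OF ab] by blast
    have "(\<lambda>m. \<integral>x. H x * bump a b m x \<partial>lborel) \<longlonglongrightarrow> (\<integral>x. H x * indicator (box a b) x \<partial>lborel)"
    proof (rule integral_dominated_convergence[where w="\<lambda>x. \<bar>H x\<bar>"])
      have "bump a b m \<in> borel_measurable borel" for m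
        by (intro borel_measurable_continuous_onI smooth_imp_continuous smooth_bump)
      then show "(\<lambda>x. H x * bump a b m x) \<in> borel_measurable lborel" for m
        using borel_measurable_integrable[OF H] by simp
      show "AE x in lborel. norm (H x * bump a b m x) \<le> \<bar>H x\<bar>" for m
        using bump_bounds[of a b m] by (auto simp: abs_mult intro!: AE_I2 mult_left_le)
      show "AE x in lborel. (\<lambda>m. H x * bump a b m x) \<longlonglongrightarrow> H x * indicator (box a b) x"
        by (intro AE_I2 tendsto_intros bump_tendsto_indicator)
    qed (use H borel_measurable_integrable[OF H] in auto)
    then show "(LINT x:box a b|lborel. H x) = 0"
      using zero by (simp add: LIMSEQ_const_iff set_lebesgue_integral_def mult.commute)
  qed
  then show ?thesis by eventually_elim (auto simp: H_def)
qed simp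

subsection \<open>The Poincare inequality on Lipschitz domains\<close>

lemma morrey_le_translate:
  assumes [measurable]: "h \<in> borel_measurable borel" "B \<in> sets borel"
    and "\<And>x. x \<in> A \<Longrightarrow> x + v \<in> B" and h: "morrey_le q lam B h K"
  shows "morrey_le q lam A (\<lambda>x. h (x + v)) K"
  unfolding morrey_le_def
proof (intro allI impI)
  fix x and R :: real assume "R > 0"
  have "(\<integral>\<^sup>+y. ennreal (norm (h (y + v)) powr q) * indicator (A \<inter> ball x R) y \<partial>lborel)
    \<le> (\<integral>\<^sup>+y. ennreal (norm (h (y + v)) powr q) * indicator (B \<inter> ball (x + v) R) (y + v) \<partial>lborel)"
    using assms(3) by (intro nn_integral_mono) (auto simp: indicator_def)
  also have "\<dots> = (\<integral>\<^sup>+y. ennreal (norm (h y) powr q) * indicator (B \<inter> ball (x + v) R) y \<partial>lborel)"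
    by (rule nn_integral_lborel_translate[where f="\<lambda>y. ennreal (norm (h y) powr q) * indicator (B \<inter> ball (x + v) R) y"]) measurable
  also have "\<dots> \<le> ennreal (K * R powr lam)" using h \<open>R > 0\<close> by (rule morrey_leD)
  finally show "(\<integral>\<^sup>+y. ennreal (norm (h (y + v)) powr q) * indicator (A \<inter> ball x R) y \<partial>lborel) \<le> ennreal (K * R powr lam)" .
qed

lemma emeasure_pos_finite:
  assumes "bounded W" "emeasure lborel W > 0"
  shows "measure lborel W > 0" "emeasure lborel W = ennreal (measure lborel W)"
  using assms emeasure_bounded_finite[of W] by (auto simp: measure_def enn2real_positive_iff)

lemma emeasure_open_pos:
  fixes W :: "'a::euclidean_space set"
  assumes "open W" "W \<noteq> {}"
  shows "emeasure lborel W > 0"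
proof -
  have "\<not> negligible W" using assms open_not_negligible by blast
  then show ?thesis
    using assms(1) by (auto simp: negligible_iff_null_sets null_sets_completion_iff null_sets_def zero_less_iff_neq_zero)
qed

text \<open>Test with the single ball of radius \<open>R0\<close>, which contains all of
  \<open>W\<close>.\<close>

lemma morrey_le_const_imp:
  assumes "morrey_le q lam W (\<lambda>_. c) K" "W \<subseteq> ball 0 R0" "W \<in> sets borel" "emeasure lborel W > 0" "0 < R0" "0 \<le> K"
  shows "norm c powr q \<le> K * R0 powr lam / measure lborel W"
proof -
  have "bounded W" using assms(2) bounded_subset bounded_ball by blast
  note W = emeasure_pos_finite[OF this assms(4)]
  have "W \<inter> ball 0 R0 = W" using assms(2) by auto
  then have "ennreal (norm c powr q) * emeasure lborel W \<le> ennreal (K * R0 powr lam)"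
    using morrey_leD[OF assms(1,5), of 0] assms(3) by (simp add: nn_integral_cmult_indicator)
  then have "norm c powr q * measure lborel W \<le> K * R0 powr lam"
    using assms(6) by (simp add: W(2) ennreal_mult[symmetric])
  then show ?thesis using W(1) by (simp add: field_simps)
qed

text \<open>\<open>C\<close> is uniform in \<open>f\<close>, \<open>g\<close> and \<open>K\<close>,
  whereas \<open>c\<close> may depend on all of them. The gradient is measured on the whole space
  rather than on \<open>A\<close>, since the segments that connect \<open>A\<close> with other sets
  leave it. Both \<open>C\<close> and \<open>K\<close> live at the level of \<open>q\<close>-th
  powers.\<close>

definition poincare_set :: "real \<Rightarrow> real \<Rightarrow> 'a::euclidean_space set \<Rightarrow> 'a set \<Rightarrow> bool" where
  "poincare_set q lam \<Omega> A \<longleftrightarrow> (\<exists>C\<ge>0. \<forall>f g K. weak_pair \<Omega> f g \<longrightarrow> 0 \<le> K \<longrightarrow> morrey_le q lam UNIV g K \<longrightarrow>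
     (\<exists>c. morrey_le q lam A (\<lambda>x. f x - c) (C * K)))"

text \<open>The constant found on \<open>B\<close> serves \<open>A\<close> as well: f(x) - c equals
  f(x + v) - c minus the increment of \<open>f\<close> along \<open>v\<close>.\<close>

lemma poincare_set_translate:
  assumes "poincare_set q lam \<Omega> B" "open A" "open B" "1 \<le> q"
    and AB: "\<And>x. x \<in> A \<Longrightarrow> x + v \<in> B"
    and sub: "\<And>x s. x \<in> A \<Longrightarrow> 0 \<le> s \<Longrightarrow> s \<le> 1 \<Longrightarrow> x + s *\<^sub>R v \<in> \<Omega>"
  shows "poincare_set q lam \<Omega> A"
proof -
  obtain C where C: "C \<ge> 0" "\<And>f g K. weak_pair \<Omega> f g \<Longrightarrow> 0 \<le> K \<Longrightarrow> morrey_le q lam UNIV g K \<Longrightarrow>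
     \<exists>c. morrey_le q lam B (\<lambda>x. f x - c) (C * K)"
    using assms(1) unfolding poincare_set_def by blast
  show ?thesis
    unfolding poincare_set_def
  proof (rule exI[of _ "2 powr q * (C + norm v powr q)"], intro conjI allI impI)
    show "2 powr q * (C + norm v powr q) \<ge> 0" using C by simp
    fix f :: "'a \<Rightarrow> real" and g :: "'a \<Rightarrow> 'a" and K
    assume fg: "weak_pair \<Omega> f g" and K: "0 \<le> K" "morrey_le q lam UNIV g K"
    note [measurable] = weak_pair_measurable[OF fg] borel_open[OF \<open>open A\<close>] borel_open[OF \<open>open B\<close>]
    obtain c where c: "morrey_le q lam B (\<lambda>x. f x - c) (C * K)" using C(2)[OF fg K] by auto
    have 1: "morrey_le q lam A (\<lambda>x. f (x + v) - c) (C * K)"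
      using morrey_le_translate[OF _ _ AB c] by simp
    have "morrey_le q lam A (\<lambda>x. f (x + v) - f x) (norm v powr q * K)"
      using weak_pair_translate_AE[OF fg \<open>open A\<close> sub] K \<open>1 \<le> q\<close>
      by (intro morrey_le_line_integral[of g]) auto
    then have 2: "morrey_le q lam A (\<lambda>x. - (f (x + v) - f x)) (norm v powr q * K)"
      by (rule morrey_le_mono) (use \<open>1 \<le> q\<close> in auto)
    have "morrey_le q lam A (\<lambda>x. (f (x + v) - c) + - (f (x + v) - f x)) (2 powr q * (C * K + norm v powr q * K))"
      by (rule morrey_le_add[OF _ _ _ 1 2]) (use \<open>1 \<le> q\<close> K C in auto)
    then show "\<exists>c. morrey_le q lam A (\<lambda>x. f x - c) (2 powr q * (C + norm v powr q) * K)"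
      by (intro exI[of _ c]) (simp add: algebra_simps)
  qed
qed

text \<open>On the overlap, a nonempty open set and so of positive measure, both approximations
  hold, and this bounds the distance of \<open>c\<close> and \<open>d\<close>. Then \<open>c\<close>
  replaces \<open>d\<close> on \<open>B\<close>; measuring the constant d - c costs the volume
  factor \<open>M\<close>.\<close>

lemma poincare_set_Un:
  assumes A: "poincare_set q lam \<Omega> A" and B: "poincare_set q lam \<Omega> B"
    and op: "open A" "open B" "A \<subseteq> \<Omega>" "B \<subseteq> \<Omega>" "A \<inter> B \<noteq> {}"
    and \<Omega>: "bounded \<Omega>" "open \<Omega>" and q: "1 \<le> q" "0 \<le> lam" "lam \<le> real DIM('a)"
  shows "poincare_set q lam (\<Omega>::'a::euclidean_space set) (A \<union> B)"
proof -
  obtain C where C: "C \<ge> 0" "\<And>f g K. weak_pair \<Omega> f g \<Longrightarrow> 0 \<le> K \<Longrightarrow> morrey_le q lam UNIV g K \<Longrightarrow>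
     \<exists>c. morrey_le q lam A (\<lambda>x. f x - c) (C * K)"
    using A unfolding poincare_set_def by blast
  obtain D where D: "D \<ge> 0" "\<And>f g K. weak_pair \<Omega> f g \<Longrightarrow> 0 \<le> K \<Longrightarrow> morrey_le q lam UNIV g K \<Longrightarrow>
     \<exists>c. morrey_le q lam B (\<lambda>x. f x - c) (D * K)"
    using B unfolding poincare_set_def by blast
  note [measurable] = borel_open[OF op(1)] borel_open[OF op(2)] borel_open[OF \<Omega>(2)]
  obtain M where M: "M > 0" "\<And>x R. R > 0 \<Longrightarrow> emeasure lborel (\<Omega> \<inter> ball x R) \<le> ennreal (M * R powr lam)"
    using bounded_measure_ball_le[OF \<Omega>(1) borel_open[OF \<Omega>(2)] q(2,3)] by metis
  obtain R0 where R0: "R0 > 0" "\<Omega> \<subseteq> ball 0 R0" using bounded_subset_ballD[OF \<Omega>(1), of 0] by auto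
  define m where "m = measure lborel (A \<inter> B)"
  have mpos: "emeasure lborel (A \<inter> B) > 0" using op by (intro emeasure_open_pos) auto
  then have m: "m > 0" unfolding m_def
    using \<Omega>(1) op by (intro emeasure_pos_finite) (auto intro: bounded_subset)
  \<comment> \<open>The Morrey bound of c - d on the overlap is 2^q (C + D) K; it is tested on the
    ball of radius \<open>R0\<close> and divided by the measure of the overlap.\<close>
  define E where "E = 2 powr q * (C + D) * R0 powr lam / m"
  have E: "E \<ge> 0" unfolding E_def using C D m by simp
  show ?thesis
    unfolding poincare_set_def
  proof (rule exI[of _ "C + 2 powr q * (D + E * M)"], intro conjI allI impI)
    show "C + 2 powr q * (D + E * M) \<ge> 0" using C D E M by simp
    fix f :: "'a \<Rightarrow> real" and g :: "'a \<Rightarrow> 'a" and K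
    assume fg: "weak_pair \<Omega> f g" and K: "0 \<le> K" "morrey_le q lam UNIV g K"
    note [measurable] = weak_pair_measurable[OF fg]
    obtain c where c: "morrey_le q lam A (\<lambda>x. f x - c) (C * K)" using C(2)[OF fg K] by auto
    obtain d where d: "morrey_le q lam B (\<lambda>x. f x - d) (D * K)" using D(2)[OF fg K] by auto
    have 1: "morrey_le q lam (A \<inter> B) (\<lambda>x. - (f x - c)) (C * K)"
      by (rule morrey_le_mono[OF c]) (use q in auto)
    have 2: "morrey_le q lam (A \<inter> B) (\<lambda>x. f x - d) (D * K)"
      by (rule morrey_le_mono[OF d]) (use q in auto)
    have "morrey_le q lam (A \<inter> B) (\<lambda>x. - (f x - c) + (f x - d)) (2 powr q * (C * K + D * K))"
      by (rule morrey_le_add[OF _ _ _ 1 2]) (use q K C D in auto)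
    then have "morrey_le q lam (A \<inter> B) (\<lambda>_. c - d) (2 powr q * (C * K + D * K))" by simp
    then have "norm (c - d) powr q \<le> 2 powr q * (C * K + D * K) * R0 powr lam / m"
      unfolding m_def by (rule morrey_le_const_imp) (use R0 op mpos K C D in auto)
    also have "\<dots> = E * K" by (simp add: E_def algebra_simps)
    finally have cd: "norm (c - d) powr q \<le> E * K" .
    have 3: "morrey_le q lam B (\<lambda>_. d - c) (E * K * M)"
      by (rule morrey_le_mono[OF morrey_le_const[OF M(2) _ M(1), where c="d - c"]])
         (use op q cd M in \<open>auto simp: norm_minus_commute abs_minus_commute\<close>)
    have "morrey_le q lam B (\<lambda>x. (f x - d) + (d - c)) (2 powr q * (D * K + E * K * M))"
      by (rule morrey_le_add[OF _ _ _ d 3]) (use q K E D M in auto)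
    then have "morrey_le q lam B (\<lambda>x. f x - c) (2 powr q * (D * K + E * K * M))" by simp
    then have "morrey_le q lam (A \<union> B) (\<lambda>x. f x - c) (C * K + 2 powr q * (D * K + E * K * M))"
      by (intro morrey_le_Un[OF _ _ _ c]) (use K C D E M in auto)
    then show "\<exists>c. morrey_le q lam (A \<union> B) (\<lambda>x. f x - c) ((C + 2 powr q * (D + E * M)) * K)"
      by (intro exI[of _ c]) (simp add: algebra_simps)
  qed
qed

text \<open>With \<open>c\<close> the mean over the ball, Jensen bounds |f(x) - c|^q by an average
  over y. Writing y = x + v and integrating over x first leaves, for each fixed v, an increment
  along one vector; convexity of the ball keeps the segments inside it.\<close>

lemma poincare_set_ball:
  fixes z :: "'a::euclidean_space"
  assumes sub: "ball z \<rho> \<subseteq> \<Omega>" and "\<rho> > 0" "1 \<le> q"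
  shows "poincare_set q lam \<Omega> (ball z \<rho>)"
proof -
  let ?B = "ball z \<rho>"
  let ?m = "measure lborel ?B"
  let ?n = "measure lborel (ball (0::'a) (2 * \<rho>))"
  have "emeasure lborel ?B > 0" using \<open>\<rho> > 0\<close> by (intro emeasure_open_pos) auto
  note m = emeasure_pos_finite[OF bounded_ball this]
  have n: "emeasure lborel (ball (0::'a) (2 * \<rho>)) = ennreal ?n"
    using \<open>\<rho> > 0\<close> by (intro emeasure_pos_finite emeasure_open_pos) auto
  \<comment> \<open>Increments within the ball are shorter than \<open>2 * \<rho>\<close>;
    \<open>?n\<close> is the volume of the ball of admissible v, and \<open>?m\<close> normalises
    the mean.\<close>
  define C where "C = ?n * (2 * \<rho>) powr q / ?m"
  interpret U: prob_space "uniform_measure lborel ?B"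
    using m by (intro prob_space_uniform_measure) auto
  show ?thesis
    unfolding poincare_set_def
  proof (rule exI[of _ C], intro conjI allI impI)
    show "C \<ge> 0" unfolding C_def using m by simp
    fix f :: "'a \<Rightarrow> real" and g :: "'a \<Rightarrow> 'a" and K
    assume fg: "weak_pair \<Omega> f g" and K: "0 \<le> K" "morrey_le q lam UNIV g K"
    note [measurable] = weak_pair_measurable[OF fg]
    define c where "c = integral\<^sup>L (uniform_measure lborel ?B) f"
    have f: "integrable lborel f" using fg by (simp add: weak_pair_def)
    have intU: "integrable (uniform_measure lborel ?B) f"
    proof (rule integrableI_bounded)
      have "(\<integral>\<^sup>+x. ennreal (norm (f x)) * indicator ?B x \<partial>lborel) \<le> (\<integral>\<^sup>+x. ennreal (norm (f x)) \<partial>lborel)"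
        by (intro nn_integral_mono) (auto simp: indicator_def)
      also have "\<dots> < \<infinity>" using f by (simp add: integrable_iff_bounded)
      finally show "(\<integral>\<^sup>+x. ennreal (norm (f x)) \<partial>uniform_measure lborel ?B) < \<infinity>"
        using m by (subst nn_integral_uniform_measure) (auto simp: ennreal_divide_eq_top_iff less_top[symmetric] not_le \<open>\<rho> > 0\<close>)
    qed measurable
    have "morrey_le q lam ?B (\<lambda>x. f x - c) (C * K)"
      unfolding morrey_le_def
    proof (intro allI impI)
      fix x0 and R :: real assume R: "R > 0"
      let ?j = "\<lambda>x v. ennreal (\<bar>f x - f (x + v)\<bar> powr q) * indicator ?B (x + v)"
      let ?k = "indicator (?B \<inter> ball x0 R) :: 'a \<Rightarrow> ennreal"
      have pt: "ennreal (norm (f x - c) powr q) \<le> (\<integral>\<^sup>+v. ?j x v \<partial>lborel) / ennreal ?m" for x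
      proof -
        have "integral\<^sup>L (uniform_measure lborel ?B) (\<lambda>y. f x - f y) = f x - c"
          unfolding c_def using intU U.prob_space by (subst Bochner_Integration.integral_diff) auto
        then have "ennreal (norm (f x - c) powr q) \<le> (\<integral>\<^sup>+y. ennreal (\<bar>f x - f y\<bar> powr q) \<partial>uniform_measure lborel ?B)"
          using U.abs_integral_powr_le_nn_integral[of "\<lambda>y. f x - f y" q] \<open>1 \<le> q\<close> by simp
        also have "\<dots> = (\<integral>\<^sup>+y. ennreal (\<bar>f x - f y\<bar> powr q) * indicator ?B y \<partial>lborel) / ennreal ?m"
          using m by (subst nn_integral_uniform_measure) auto
        also have "(\<integral>\<^sup>+y. ennreal (\<bar>f x - f y\<bar> powr q) * indicator ?B y \<partial>lborel)
          = (\<integral>\<^sup>+v. ennreal (\<bar>f x - f (v + x)\<bar> powr q) * indicator ?B (v + x) \<partial>lborel)"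
          by (rule nn_integral_lborel_translate[symmetric]) measurable
        finally show ?thesis by (simp add: add.commute)
      qed
      have "(\<integral>\<^sup>+x. (\<integral>\<^sup>+v. ?j x v * ?k x \<partial>lborel) \<partial>lborel) = (\<integral>\<^sup>+v. (\<integral>\<^sup>+x. ?j x v * ?k x \<partial>lborel) \<partial>lborel)"
        by (rule lborel_pair.Fubini') measurable
      also have "\<dots> \<le> (\<integral>\<^sup>+v. ennreal ((2 * \<rho>) powr q * K * R powr lam) * indicator (ball (0::'a) (2 * \<rho>)) v \<partial>lborel)"
      proof (rule nn_integral_mono)
        fix v :: 'a
        show "(\<integral>\<^sup>+x. ?j x v * ?k x \<partial>lborel) \<le> ennreal ((2 * \<rho>) powr q * K * R powr lam) * indicator (ball (0::'a) (2 * \<rho>)) v"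
        proof (cases "norm v < 2 * \<rho>")
          case True
          \<comment> \<open>Absorbs both indicators of \<open>?B\<close> in the double integral, and
            is open as the almost-everywhere identity demands.\<close>
          define S where "S = ?B \<inter> (\<lambda>x. x + v) -` ?B"
          have "open S" unfolding S_def by (intro open_Int open_ball open_vimage continuous_intros)
          have "x + s *\<^sub>R v \<in> \<Omega>" if "x \<in> S" "0 \<le> s" "s \<le> 1" for x s
          proof -
            have "(1 - s) *\<^sub>R x + s *\<^sub>R (x + v) \<in> ?B"
              using that by (intro convexD[OF convex_ball]) (auto simp: S_def)
            then show ?thesis using sub by (auto simp: algebra_simps)
          qed
          then have "AE x in lborel. x \<in> S \<longrightarrow> f (x + v) - f x = (\<integral>s. g (x + s *\<^sub>R v) \<bullet> v \<partial>unit_interval_measure)"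
            by (rule weak_pair_translate_AE[OF fg \<open>open S\<close>])
          then have "morrey_le q lam S (\<lambda>x. f (x + v) - f x) (norm v powr q * K)"
            using K \<open>1 \<le> q\<close> by (intro morrey_le_line_integral[of g]) auto
          then have "(\<integral>\<^sup>+x. ennreal (norm (f (x + v) - f x) powr q) * indicator (S \<inter> ball x0 R) x \<partial>lborel)
            \<le> ennreal (norm v powr q * K * R powr lam)" using R by (rule morrey_leD)
          also have "\<dots> \<le> ennreal ((2 * \<rho>) powr q * K * R powr lam)"
            using True K \<open>1 \<le> q\<close> by (intro ennreal_leI mult_right_mono powr_mono2) auto
          also have "(\<integral>\<^sup>+x. ennreal (norm (f (x + v) - f x) powr q) * indicator (S \<inter> ball x0 R) x \<partial>lborel)
            = (\<integral>\<^sup>+x. ?j x v * ?k x \<partial>lborel)"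
            by (intro nn_integral_cong) (auto simp: S_def indicator_def abs_minus_commute)
          finally show ?thesis using True by simp
        next
          case False
          have "\<not> (x \<in> ?B \<and> x + v \<in> ?B)" for x
            using False dist_triangle_half_l[of x z "2 * \<rho>" "x + v"] by (auto simp: dist_commute dist_norm)
          then have "?j x v * ?k x = 0" for x by (auto simp: indicator_def)
          then have "(\<integral>\<^sup>+x. ?j x v * ?k x \<partial>lborel) = (\<integral>\<^sup>+x. 0 \<partial>(lborel :: 'a measure))"
            by (intro nn_integral_cong)
          then show ?thesis by simp
        qed
      qed
      also have "\<dots> = ennreal ((2 * \<rho>) powr q * K * R powr lam) * ennreal ?n"
        by (simp add: nn_integral_cmult_indicator n)
      finally have dbl: "(\<integral>\<^sup>+x. (\<integral>\<^sup>+v. ?j x v * ?k x \<partial>lborel) \<partial>lborel)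
        \<le> ennreal ((2 * \<rho>) powr q * K * R powr lam) * ennreal ?n" .
      have "(\<integral>\<^sup>+x. ennreal (norm (f x - c) powr q) * ?k x \<partial>lborel)
        \<le> (\<integral>\<^sup>+x. (\<integral>\<^sup>+v. ?j x v \<partial>lborel) / ennreal ?m * ?k x \<partial>lborel)"
        using pt by (intro nn_integral_mono mult_right_mono) auto
      also have "\<dots> = (\<integral>\<^sup>+x. inverse (ennreal ?m) * (\<integral>\<^sup>+v. ?j x v * ?k x \<partial>lborel) \<partial>lborel)"
        by (intro nn_integral_cong, subst nn_integral_multc) (auto simp: divide_ennreal_def mult_ac)
      also have "\<dots> = inverse (ennreal ?m) * (\<integral>\<^sup>+x. (\<integral>\<^sup>+v. ?j x v * ?k x \<partial>lborel) \<partial>lborel)"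
        by (rule nn_integral_cmult) measurable
      also have "\<dots> \<le> inverse (ennreal ?m) * (ennreal ((2 * \<rho>) powr q * K * R powr lam) * ennreal ?n)"
        using dbl by (intro mult_left_mono) auto
      also have "\<dots> = ennreal (C * K * R powr lam)"
        using m K by (simp add: inverse_ennreal ennreal_mult[symmetric] C_def field_simps)
      finally show "(\<integral>\<^sup>+x. ennreal (norm (f x - c) powr q) * ?k x \<partial>lborel) \<le> ennreal (C * K * R powr lam)" .
    qed
    then show "\<exists>c. morrey_le q lam ?B (\<lambda>x. f x - c) (C * K)" ..
  qed
qed

text \<open>Take a maximal nonempty subfamily whose union satisfies \<open>P\<close>. If sets are
  left over, their union and that of the subfamily are nonempty open sets covering a connected set,
  so they meet; adding a leftover set that meets the subfamily contradicts maximality.\<close>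

lemma connected_Union_open_induct:
  assumes "finite \<A>" "\<A> \<noteq> {}" "\<And>A. A \<in> \<A> \<Longrightarrow> open A \<and> A \<noteq> {} \<and> P A" "connected (\<Union>\<A>)"
    and Un: "\<And>A B. open A \<Longrightarrow> open B \<Longrightarrow> A \<subseteq> \<Union>\<A> \<Longrightarrow> B \<subseteq> \<Union>\<A> \<Longrightarrow> A \<inter> B \<noteq> {} \<Longrightarrow> P A \<Longrightarrow> P B \<Longrightarrow> P (A \<union> B)"
  shows "P (\<Union>\<A>)"
proof -
  let ?S = "{F. F \<subseteq> \<A> \<and> F \<noteq> {} \<and> P (\<Union>F)}"
  obtain A0 where "A0 \<in> \<A>" using assms(2) by auto
  then have "{A0} \<in> ?S" using assms(3) by simp
  then have ne: "?S \<noteq> {}" by blast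
  have fin: "finite ?S" by (rule finite_subset[of _ "Pow \<A>"]) (use assms(1) in auto)
  from finite_has_maximal[OF fin ne] obtain F
    where F: "F \<in> ?S" and max: "\<forall>F'\<in>?S. F \<subseteq> F' \<longrightarrow> F = F'" by (rule bexE)
  have "F = \<A>"
  proof (rule ccontr)
    assume "F \<noteq> \<A>"
    have opn: "open (\<Union>F)" "open (\<Union>(\<A> - F))" using F assms(3) by (blast intro: open_Union)+
    have "\<Union>F \<noteq> {}" "\<Union>(\<A> - F) \<noteq> {}" using F \<open>F \<noteq> \<A>\<close> assms(3) by blast+
    moreover have "\<Union>\<A> = \<Union>F \<union> \<Union>(\<A> - F)" using F by auto
    ultimately have "\<Union>F \<inter> \<Union>(\<A> - F) \<noteq> {}"
      using connectedD[OF assms(4) opn] by blast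
    then obtain A where A: "A \<in> \<A>" "A \<notin> F" "\<Union>F \<inter> A \<noteq> {}" by blast
    have "P (\<Union>F \<union> A)" by (rule Un) (use F A assms(3) opn in auto)
    then have "insert A F \<in> ?S" using F A by (auto simp: Un_commute)
    then show False using max A(2) by blast
  qed
  then show ?thesis using F by simp
qed

text \<open>Moving against \<open>e\<close> keeps the projection \<open>\<pi>\<close> and lowers the
  height, so a downward segment starting in \<open>\<Omega>\<close> remains there as long as it
  stays in the chart. The ball that receives the translated piece must lie wholly below the graph,
  and this is where the Lipschitz constant decides the radius.\<close>

lemma lipschitz_domain_boundary_poincare:
  fixes \<Omega> :: "'a::euclidean_space set"
  assumes "lipschitz_domain \<Omega>" "p \<in> frontier \<Omega>" "1 \<le> q"
  obtains W where "open W" "p \<in> W" "poincare_set q lam \<Omega> (\<Omega> \<inter> W)"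
proof -
  have "open \<Omega>" using assms(1) by (simp add: lipschitz_domain_def)
  obtain r e h L where r: "r > 0" and e: "norm e = 1" and h: "lipschitz_on L {y. y \<bullet> e = 0} (h :: 'a \<Rightarrow> real)"
    and graph: "\<Omega> \<inter> ball p r = {x \<in> ball p r. x \<bullet> e < h (x - (x \<bullet> e) *\<^sub>R e)}"
    using assms unfolding lipschitz_domain_def by meson
  have ee: "e \<bullet> e = 1" using e by (simp add: norm_eq_1)
  have L: "L \<ge> 0" using h by (rule lipschitz_on_nonneg)
  define \<pi> where "\<pi> x = x - (x \<bullet> e) *\<^sub>R e" for x :: 'a
  have \<pi>e: "\<pi> x \<bullet> e = 0" for x by (simp add: \<pi>_def inner_diff_left ee)
  have \<pi>shift: "\<pi> (x + t *\<^sub>R e) = \<pi> x" for x t by (simp add: \<pi>_def inner_add_left ee algebra_simps)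
  have \<pi>norm: "norm (\<pi> x) \<le> norm x" for x
  proof (rule power2_le_imp_le)
    have "(norm (\<pi> x))\<^sup>2 = (norm x)\<^sup>2 - (x \<bullet> e)\<^sup>2"
      unfolding \<pi>_def power2_norm_eq_inner
      by (simp add: inner_diff_left inner_diff_right ee inner_commute power2_eq_square algebra_simps)
    then show "(norm (\<pi> x))\<^sup>2 \<le> (norm x)\<^sup>2" by simp
  qed simp
  have \<pi>diff: "\<pi> x - \<pi> y = \<pi> (x - y)" for x y by (simp add: \<pi>_def inner_diff_left algebra_simps)
  have hlip: "\<bar>h (\<pi> x) - h (\<pi> y)\<bar> \<le> L * norm (x - y)" for x y
  proof -
    have "\<bar>h (\<pi> x) - h (\<pi> y)\<bar> \<le> L * norm (\<pi> x - \<pi> y)"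
      using lipschitz_onD[OF h, of "\<pi> x" "\<pi> y"] \<pi>e by (simp add: dist_norm)
    also have "\<dots> \<le> L * norm (x - y)" unfolding \<pi>diff using L by (intro mult_left_mono \<pi>norm)
    finally show ?thesis .
  qed
  have memb: "x \<in> \<Omega> \<longleftrightarrow> x \<bullet> e < h (\<pi> x)" if "x \<in> ball p r" for x
    using graph that unfolding \<pi>_def by blast
  have inner_le: "\<bar>x \<bullet> e\<bar> \<le> norm x" for x :: 'a
    using Cauchy_Schwarz_ineq2[of x e] e by simp
  \<comment> \<open>\<open>p\<close> is a limit of points below the graph, and the inequality
    survives in its non-strict form. Height and graph have Lipschitz constants 1 and
    \<open>L\<close>, hence the \<open>1 + L\<close> in \<open>d\<close>.\<close>
  have top: "p \<bullet> e \<le> h (\<pi> p)"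
  proof (rule field_le_epsilon)
    fix \<epsilon> :: real assume "\<epsilon> > 0"
    define d where "d = min r (\<epsilon> / (1 + L))"
    have "d > 0" using r L \<open>\<epsilon> > 0\<close> by (simp add: d_def)
    moreover have "p \<in> closure \<Omega>" using assms(2) by (simp add: frontier_def)
    ultimately obtain x where x: "x \<in> \<Omega>" "dist x p < d" by (auto simp: closure_approachable)
    then have "x \<bullet> e < h (\<pi> x)" using memb[of x] by (auto simp: d_def dist_commute)
    moreover have "\<bar>h (\<pi> x) - h (\<pi> p)\<bar> \<le> L * norm (x - p)" by (rule hlip)
    moreover have "\<bar>p \<bullet> e - x \<bullet> e\<bar> \<le> norm (x - p)" using inner_le[of "p - x"] by (simp add: inner_diff_left norm_minus_commute)
    moreover have "(1 + L) * norm (x - p) \<le> \<epsilon>"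
    proof -
      have "norm (x - p) \<le> \<epsilon> / (1 + L)" using x by (simp add: d_def dist_norm)
      then show ?thesis using L by (simp add: field_simps)
    qed
    ultimately show "p \<bullet> e \<le> h (\<pi> p) + \<epsilon>" by (simp add: algebra_simps)
  qed
  \<comment> \<open>The depth is half the chart radius. The choice of \<open>\<rho>\<close> gives (1
    + L) rho = T/2: within the radius rho, height and graph together vary by less than the depth.
    Moreover T + rho < r, so all points stay in the chart.\<close>
  define T where "T = r / 2"
  define \<rho> where "\<rho> = T / (2 * (1 + L))"
  have T: "T > 0" using r by (simp add: T_def)
  then have \<rho>: "\<rho> > 0" using L by (simp add: \<rho>_def)
  have "(1 + L) * \<rho> = T / 2" using L by (simp add: \<rho>_def field_simps)
  moreover have "L * \<rho> \<ge> 0" using L \<rho> by simp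
  ultimately have \<rho>2: "(1 + L) * \<rho> < T" and \<rho>3: "\<rho> \<le> T / 2"
    using T by (auto simp: algebra_simps)
  have "ball (p - T *\<^sub>R e) \<rho> \<subseteq> \<Omega>"
  proof
    fix y assume "y \<in> ball (p - T *\<^sub>R e) \<rho>"
    then have y: "norm (y - (p - T *\<^sub>R e)) < \<rho>" by (simp add: dist_norm norm_minus_commute)
    have "norm (y - p) \<le> norm (y - (p - T *\<^sub>R e)) + norm (- T *\<^sub>R e)"
      using norm_triangle_ineq[of "y - (p - T *\<^sub>R e)" "- T *\<^sub>R e"] by simp
    then have "norm (y - p) < r" using y T e \<rho>3 by (simp add: T_def)
    then have "y \<in> ball p r" by (simp add: dist_norm norm_minus_commute)
    moreover have "y \<bullet> e < h (\<pi> y)"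
    proof -
      have "\<bar>(y - (p - T *\<^sub>R e)) \<bullet> e\<bar> < \<rho>" using inner_le[of "y - (p - T *\<^sub>R e)"] y by simp
      then have "y \<bullet> e < p \<bullet> e - T + \<rho>" by (simp add: inner_diff_left ee abs_less_iff algebra_simps)
      moreover have "\<bar>h (\<pi> y) - h (\<pi> (p - T *\<^sub>R e))\<bar> \<le> L * \<rho>"
        using hlip[of y "p - T *\<^sub>R e"] y L mult_left_mono[of "norm (y - (p - T *\<^sub>R e))" \<rho> L] by simp
      moreover have "\<pi> (p - T *\<^sub>R e) = \<pi> p" using \<pi>shift[of p "- T"] by simp
      ultimately show ?thesis using top \<rho>2 by (simp add: algebra_simps abs_le_iff)
    qed
    ultimately show "y \<in> \<Omega>" using memb by blast
  qed
  then have ball: "poincare_set q lam \<Omega> (ball (p - T *\<^sub>R e) \<rho>)"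
    using \<rho> assms by (intro poincare_set_ball) auto
  have "poincare_set q lam \<Omega> (\<Omega> \<inter> ball p \<rho>)"
  proof (rule poincare_set_translate[OF ball, where v="- T *\<^sub>R e"])
    show "x + - T *\<^sub>R e \<in> ball (p - T *\<^sub>R e) \<rho>" if "x \<in> \<Omega> \<inter> ball p \<rho>" for x
      using that by (simp add: dist_norm)
    show "x + s *\<^sub>R (- T *\<^sub>R e) \<in> \<Omega>" if x: "x \<in> \<Omega> \<inter> ball p \<rho>" and s: "0 \<le> s" "s \<le> 1" for x s
    proof -
      have xp: "norm (x - p) < \<rho>" using x by (simp add: dist_norm norm_minus_commute)
      have "norm (x + s *\<^sub>R (- T *\<^sub>R e) - p) \<le> norm (x - p) + norm (- (s * T) *\<^sub>R e)"
        using norm_triangle_ineq[of "x - p" "- (s * T) *\<^sub>R e"] by (simp add: algebra_simps)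
      also have "\<dots> = norm (x - p) + s * T" using T s e by (simp add: abs_mult)
      also have "s * T \<le> T" using s T by (simp add: mult_left_le_one_le)
      finally have "norm (x + s *\<^sub>R (- T *\<^sub>R e) - p) \<le> norm (x - p) + T" by simp
      also have "\<dots> < r"
      proof -
        have "r = 2 * T" by (simp add: T_def)
        then show ?thesis using xp \<rho>3 T by linarith
      qed
      finally have "x + s *\<^sub>R (- T *\<^sub>R e) \<in> ball p r" by (simp add: dist_norm norm_minus_commute)
      moreover have "x \<bullet> e < h (\<pi> x)" using memb[of x] x xp \<rho>3 T by (auto simp: T_def)
      moreover have "\<pi> (x + s *\<^sub>R (- T *\<^sub>R e)) = \<pi> x" using \<pi>shift[of x "- (s * T)"] by simp
      moreover have "(x + s *\<^sub>R (- T *\<^sub>R e)) \<bullet> e \<le> x \<bullet> e" using s T by (simp add: inner_diff_left ee)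
      ultimately show ?thesis using memb by simp
    qed
  qed (use \<open>open \<Omega>\<close> assms in auto)
  then show ?thesis using that[of "ball p \<rho>"] \<rho> by simp
qed

theorem lipschitz_domain_poincare:
  fixes \<Omega> :: "'a::euclidean_space set"
  assumes "bounded \<Omega>" "connected \<Omega>" "lipschitz_domain \<Omega>" "\<Omega> \<noteq> {}"
    and q: "1 \<le> q" "0 \<le> lam" "lam \<le> real DIM('a)"
  shows "poincare_set q lam \<Omega> \<Omega>"
proof -
  have op: "open \<Omega>" using assms(3) by (simp add: lipschitz_domain_def)
  have "\<exists>W. open W \<and> p \<in> W \<and> poincare_set q lam \<Omega> (\<Omega> \<inter> W)" if p: "p \<in> closure \<Omega>" for p
  proof (cases "p \<in> \<Omega>")
    case True
    then obtain \<rho> where \<rho>: "\<rho> > 0" "ball p \<rho> \<subseteq> \<Omega>" using op open_contains_ball by blast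
    then have "\<Omega> \<inter> ball p \<rho> = ball p \<rho>" by auto
    then show ?thesis using poincare_set_ball[OF \<rho>(2,1) q(1)] \<rho>(1) by (intro exI[of _ "ball p \<rho>"]) auto
  next
    case False
    then have "p \<in> frontier \<Omega>" using p op by (simp add: frontier_def interior_open)
    then show ?thesis using lipschitz_domain_boundary_poincare[OF assms(3) _ q(1)] by metis
  qed
  then obtain W where W: "\<And>p. p \<in> closure \<Omega> \<Longrightarrow> open (W p) \<and> p \<in> W p \<and> poincare_set q lam \<Omega> (\<Omega> \<inter> W p)"
    by metis
  have "compact (closure \<Omega>)" using assms(1) by (simp add: compact_closure)
  then obtain I where I: "I \<subseteq> closure \<Omega>" "finite I" "closure \<Omega> \<subseteq> (\<Union>p\<in>I. W p)"
    by (rule compactE_image[of _ "closure \<Omega>" W]) (use W in blast)+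
  \<comment> \<open>Discarding the empty set supplies the nonemptiness that the induction over open
    pieces asks for.\<close>
  define \<A> where "\<A> = (\<lambda>p. \<Omega> \<inter> W p) ` I - {{}}"
  have "\<Union>\<A> = \<Omega> \<inter> (\<Union>p\<in>I. W p)" unfolding \<A>_def by auto
  then have Un: "\<Union>\<A> = \<Omega>" using I(3) closure_subset[of \<Omega>] by auto
  have "poincare_set q lam \<Omega> (\<Union>\<A>)"
  proof (rule connected_Union_open_induct)
    show "finite \<A>" using I by (simp add: \<A>_def)
    show "\<A> \<noteq> {}" using Un assms(4) by auto
    show "open A \<and> A \<noteq> {} \<and> poincare_set q lam \<Omega> A" if "A \<in> \<A>" for A
      using that W I op by (auto simp: \<A>_def)
    show "connected (\<Union>\<A>)" using Un assms(2) by simp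
    show "poincare_set q lam \<Omega> (A \<union> B)"
      if "open A" "open B" "A \<subseteq> \<Union>\<A>" "B \<subseteq> \<Union>\<A>" "A \<inter> B \<noteq> {}" "poincare_set q lam \<Omega> A" "poincare_set q lam \<Omega> B" for A B
      using that op assms Un by (intro poincare_set_Un) auto
  qed
  then show ?thesis by (simp add: Un)
qed

subsection \<open>Borel representatives\<close>

text \<open>The theorem speaks of Lebesgue measurable functions on \<open>\<Omega>\<close>, whereas
  Fubini and translation are carried out with Borel functions on the whole space. The representative
  vanishes at every point outside \<open>\<Omega>\<close>, so bounds over arbitrary balls see only
  \<open>\<Omega>\<close>.\<close>

definition borel_version :: "'a::euclidean_space set \<Rightarrow> ('a \<Rightarrow> 'b::real_normed_vector) \<Rightarrow> ('a \<Rightarrow> 'b) \<Rightarrow> bool" where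
  "borel_version \<Omega> f f' \<longleftrightarrow> f' \<in> borel_measurable borel \<and> (\<forall>x. x \<notin> \<Omega> \<longrightarrow> f' x = 0) \<and>
     (AE x in lborel. indicator \<Omega> x *\<^sub>R f x = f' x)"

text \<open>The completion supplies Borel representatives of real functions, so the coordinates are
  replaced one by one and reassembled; the finitely many null sets do no harm.\<close>

lemma ex_borel_version:
  fixes f :: "'a::euclidean_space \<Rightarrow> 'b::euclidean_space"
  assumes "f \<in> borel_measurable (lebesgue_on \<Omega>)" "\<Omega> \<in> sets borel"
  obtains f' where "borel_version \<Omega> f f'"
proof -
  have "(\<lambda>x. indicator \<Omega> x *\<^sub>R f x) \<in> borel_measurable lebesgue"
    using assms by (subst borel_measurable_restrict_space_iff[symmetric]) auto
  then have "(\<lambda>x. (indicator \<Omega> x *\<^sub>R f x) \<bullet> i) \<in> borel_measurable lebesgue" for i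
    by measurable
  then have "\<exists>h\<in>borel_measurable lborel. AE x in lborel. (indicator \<Omega> x *\<^sub>R f x) \<bullet> i = h x" for i
    by (rule completion_ex_borel_measurable_real)
  then have "\<forall>i. \<exists>h. h \<in> borel_measurable lborel \<and> (AE x in lborel. (indicator \<Omega> x *\<^sub>R f x) \<bullet> i = h x)"
    by blast
  from choice[OF this] obtain h where h: "\<And>i. h i \<in> borel_measurable borel"
    "\<And>i. AE x in lborel. (indicator \<Omega> x *\<^sub>R f x) \<bullet> i = h i x"
    by auto
  note [measurable] = h(1) assms(2)
  define f' where "f' x = indicator \<Omega> x *\<^sub>R (\<Sum>i\<in>Basis. h i x *\<^sub>R i)" for x
  have "AE x in lborel. \<forall>i\<in>Basis. (indicator \<Omega> x *\<^sub>R f x) \<bullet> i = h i x"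
    using h(2) by (subst AE_ball_countable) (auto intro: countable_finite)
  then have "AE x in lborel. indicator \<Omega> x *\<^sub>R f x = f' x"
  proof eventually_elim
    case (elim x)
    then have "(\<Sum>i\<in>Basis. h i x *\<^sub>R i) = (\<Sum>i\<in>Basis. ((indicator \<Omega> x *\<^sub>R f x) \<bullet> i) *\<^sub>R i)"
      by (intro sum.cong) auto
    also have "\<dots> = indicator \<Omega> x *\<^sub>R f x" by (rule euclidean_representation)
    finally show ?case by (simp add: f'_def indicator_def)
  qed
  moreover have "f' \<in> borel_measurable borel" unfolding f'_def[abs_def] by measurable
  ultimately have "borel_version \<Omega> f f'" by (auto simp: borel_version_def f'_def)
  then show ?thesis by (rule that)
qed

lemma borel_version_nn_integral:
  assumes "borel_version \<Omega> f f'" "A \<subseteq> \<Omega>"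
  shows "(\<integral>\<^sup>+y. ennreal (norm (f y) powr q) * indicator A y \<partial>lebesgue)
    = (\<integral>\<^sup>+y. ennreal (norm (f' y) powr q) * indicator A y \<partial>lborel)"
  unfolding nn_integral_completion
proof (rule nn_integral_cong_AE)
  have "AE x in lborel. indicator \<Omega> x *\<^sub>R f x = f' x" using assms(1) by (simp add: borel_version_def)
  then show "AE y in lborel. ennreal (norm (f y) powr q) * indicator A y = ennreal (norm (f' y) powr q) * indicator A y"
    by eventually_elim (use assms(2) in \<open>auto simp: indicator_def split: if_splits\<close>)
qed

lemma borel_version_diff:
  fixes f h :: "'a::euclidean_space \<Rightarrow> 'b::euclidean_space"
  assumes "borel_version \<Omega> f f'" "h \<in> borel_measurable borel" "\<And>x. x \<notin> \<Omega> \<Longrightarrow> h x = 0"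
  shows "borel_version \<Omega> (\<lambda>x. f x - h x) (\<lambda>x. f' x - h x)"
proof -
  have "AE x in lborel. indicator \<Omega> x *\<^sub>R f x = f' x" using assms(1) by (simp add: borel_version_def)
  then have "AE x in lborel. indicator \<Omega> x *\<^sub>R (f x - h x) = f' x - h x"
    by eventually_elim (use assms(3) in \<open>auto simp: indicator_def split: if_splits\<close>)
  then show ?thesis using assms by (auto simp: borel_version_def)
qed

section \<open>Between the Morrey norm and bounds on representatives\<close>

lemma morrey_norm_nonneg:
  assumes "in_morrey q lam \<Omega> f" "\<Omega> \<noteq> {}"
  shows "0 \<le> morrey_norm q lam \<Omega> f"
proof -
  obtain x where x: "x \<in> \<Omega>" using assms(2) by auto
  let ?v = "1 powr (- lam / q) * local_Lq q (\<Omega> \<inter> ball x 1) f"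
  have "?v \<in> morrey_vals q lam \<Omega> f"
    unfolding morrey_vals_def using x by (auto intro!: exI[of _ x] exI[of _ "1::real"])
  then have "?v \<le> morrey_norm q lam \<Omega> f"
    unfolding morrey_norm_def using assms(1) by (intro cSup_upper) (auto simp: in_morrey_def)
  moreover have "0 \<le> ?v" by (simp add: local_Lq_def)
  ultimately show ?thesis by simp
qed

text \<open>The factor \<open>2 powr lam\<close> pays for centres outside \<open>\<Omega>\<close>: a ball meeting \<open>\<Omega>\<close> lies in a ball
  of twice the radius centred in \<open>\<Omega>\<close>.\<close>
lemma in_morrey_imp_morrey_le:
  fixes f :: "'a::euclidean_space \<Rightarrow> 'b::euclidean_space"
  assumes f: "in_morrey q lam \<Omega> f" and "0 < q" "0 \<le> lam" and f': "borel_version \<Omega> f f'" and "\<Omega> \<noteq> {}"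
  shows "morrey_le q lam UNIV f' (2 powr lam * morrey_norm q lam \<Omega> f powr q)"
  unfolding morrey_le_def
proof (intro allI impI)
  define N where "N = morrey_norm q lam \<Omega> f"
  have "N \<ge> 0" unfolding N_def using f \<open>\<Omega> \<noteq> {}\<close> by (rule morrey_norm_nonneg)
  have centred: "(\<integral>\<^sup>+y. ennreal (norm (f' y) powr q) * indicator (\<Omega> \<inter> ball x R) y \<partial>lborel) \<le> ennreal (N powr q * R powr lam)"
    if x: "x \<in> \<Omega>" and R: "R > 0" for x R
  proof -
    define I where "I = (LINT y:\<Omega> \<inter> ball x R|lebesgue. norm (f y) powr q)"
    have int: "set_integrable lebesgue (\<Omega> \<inter> ball x R) (\<lambda>y. norm (f y) powr q)"
      using f by (simp add: in_morrey_def)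
    have I0: "I \<ge> 0" unfolding I_def set_lebesgue_integral_def by (intro integral_nonneg_AE) auto
    have "R powr (- lam / q) * local_Lq q (\<Omega> \<inter> ball x R) f \<le> N"
      unfolding N_def morrey_norm_def using f x R
      by (intro cSup_upper) (auto simp: in_morrey_def morrey_vals_def)
    then have "R powr (- lam / q) * I powr (1 / q) \<le> N" by (simp add: local_Lq_def I_def)
    then have "(R powr (- lam / q) * I powr (1 / q)) powr q \<le> N powr q"
      using \<open>0 < q\<close> I0 by (intro powr_mono2) auto
    then have "R powr (- lam) * I \<le> N powr q"
      using \<open>0 < q\<close> I0 R by (simp add: powr_mult powr_powr)
    then have "I \<le> N powr q * R powr lam"
      using R by (simp add: powr_minus field_simps)
    moreover have "(\<integral>\<^sup>+y. ennreal (norm (f y) powr q) * indicator (\<Omega> \<inter> ball x R) y \<partial>lebesgue) = ennreal I"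
      using nn_integral_eq_integral[OF int[unfolded set_integrable_def]]
      by (simp add: I_def set_lebesgue_integral_def ennreal_mult' ennreal_indicator mult.commute)
    ultimately show ?thesis
      using borel_version_nn_integral[OF f', of "\<Omega> \<inter> ball x R" q] by (simp add: ennreal_leI)
  qed
  fix x and R :: real assume R: "R > 0"
  have out: "f' y = 0" if "y \<notin> \<Omega>" for y using f' that by (simp add: borel_version_def)
  show "(\<integral>\<^sup>+y. ennreal (norm (f' y) powr q) * indicator (UNIV \<inter> ball x R) y \<partial>lborel)
    \<le> ennreal (2 powr lam * morrey_norm q lam \<Omega> f powr q * R powr lam)"
  proof (cases "\<Omega> \<inter> ball x R = {}")
    case True
    then have "ennreal (norm (f' y) powr q) * indicator (UNIV \<inter> ball x R) y = 0" for y
      using out[of y] by (cases "y \<in> \<Omega>") (auto simp: indicator_def)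
    then have "(\<integral>\<^sup>+y. ennreal (norm (f' y) powr q) * indicator (UNIV \<inter> ball x R) y \<partial>lborel) = (\<integral>\<^sup>+y. 0 \<partial>(lborel :: 'a measure))"
      by (intro nn_integral_cong)
    then show ?thesis by simp
  next
    case False
    then obtain z where z: "z \<in> \<Omega>" "dist x z < R" by auto
    have "ball x R \<subseteq> ball z (2 * R)"
    proof
      fix y assume "y \<in> ball x R"
      then show "y \<in> ball z (2 * R)" using z dist_triangle3[of z y x] by auto
    qed
    then have "(\<integral>\<^sup>+y. ennreal (norm (f' y) powr q) * indicator (UNIV \<inter> ball x R) y \<partial>lborel)
      \<le> (\<integral>\<^sup>+y. ennreal (norm (f' y) powr q) * indicator (\<Omega> \<inter> ball z (2 * R)) y \<partial>lborel)"
      using out by (intro nn_integral_mono) (force simp: indicator_def)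
    also have "\<dots> \<le> ennreal (N powr q * (2 * R) powr lam)" using z R by (intro centred) auto
    also have "N powr q * (2 * R) powr lam = 2 powr lam * morrey_norm q lam \<Omega> f powr q * R powr lam"
      using R by (simp add: powr_mult N_def)
    finally show ?thesis .
  qed
qed

text \<open>No constant is lost in this direction, as balls centred in \<open>\<Omega>\<close> are
  among those already controlled. This is where the \<open>q\<close>-th root is taken.\<close>

lemma morrey_le_imp_in_morrey:
  fixes f :: "'a::euclidean_space \<Rightarrow> 'b::euclidean_space"
  assumes meas: "f \<in> borel_measurable (lebesgue_on \<Omega>)" and \<Omega>: "\<Omega> \<in> sets borel" "\<Omega> \<noteq> {}"
    and f': "borel_version \<Omega> f f'" and le: "morrey_le q lam \<Omega> f' K" and "0 \<le> K" "0 < q"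
  shows "in_morrey q lam \<Omega> f" "morrey_norm q lam \<Omega> f \<le> K powr (1 / q)"
proof -
  have nn: "(\<integral>\<^sup>+y. ennreal (norm (f y) powr q) * indicator (\<Omega> \<inter> ball x R) y \<partial>lebesgue) \<le> ennreal (K * R powr lam)"
    if "R > 0" for x R
    using borel_version_nn_integral[OF f', of "\<Omega> \<inter> ball x R" q] morrey_leD[OF le that, of x] by simp
  have [measurable]: "(\<lambda>x. indicator \<Omega> x *\<^sub>R f x) \<in> borel_measurable lebesgue"
    using meas \<Omega> by (subst borel_measurable_restrict_space_iff[symmetric]) auto
  have eq: "indicator (\<Omega> \<inter> ball x R) y *\<^sub>R norm (f y) powr q
    = indicator (ball x R) y * norm (indicator \<Omega> y *\<^sub>R f y) powr q" for x y R
    using \<open>0 < q\<close> by (auto simp: indicator_def)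
  have "ball x R \<in> sets lebesgue" for x :: 'a and R by simp
  then have m: "(\<lambda>y. indicator (\<Omega> \<inter> ball x R) y *\<^sub>R norm (f y) powr q) \<in> borel_measurable lebesgue" for x R
    unfolding eq by measurable
  have norm_eq: "(\<integral>\<^sup>+y. ennreal (indicator (\<Omega> \<inter> ball x R) y *\<^sub>R norm (f y) powr q) \<partial>lebesgue)
    = (\<integral>\<^sup>+y. ennreal (norm (f y) powr q) * indicator (\<Omega> \<inter> ball x R) y \<partial>lebesgue)" for x R
    by (intro nn_integral_cong) (auto simp: indicator_def)
  have int: "set_integrable lebesgue (\<Omega> \<inter> ball x R) (\<lambda>y. norm (f y) powr q)" for x R
  proof (cases "R > 0")
    case True
    show ?thesis
      unfolding set_integrable_def
    proof (rule integrableI_nonneg[OF m])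
      have "(\<integral>\<^sup>+y. ennreal (indicator (\<Omega> \<inter> ball x R) y *\<^sub>R norm (f y) powr q) \<partial>lebesgue) \<le> ennreal (K * R powr lam)"
        unfolding norm_eq by (rule nn[OF True])
      then show "(\<integral>\<^sup>+y. ennreal (indicator (\<Omega> \<inter> ball x R) y *\<^sub>R norm (f y) powr q) \<partial>lebesgue) < \<infinity>"
        using le_less_trans ennreal_less_top by (metis infinity_ennreal_def)
    qed auto
  next
    case False
    \<comment> \<open>Membership asks for integrability at every real \<open>R\<close>; without
      positive radius the ball is empty.\<close>
    then have "\<Omega> \<inter> ball x R = {}" by (simp add: ball_empty)
    then show ?thesis by (simp add: set_integrable_def)
  qed
  have val: "v \<le> K powr (1 / q)" if vin: "v \<in> morrey_vals q lam \<Omega> f" for v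
  proof -
    obtain x R where v: "v = R powr (- lam / q) * local_Lq q (\<Omega> \<inter> ball x R) f" and R: "R > 0"
      using vin unfolding morrey_vals_def by blast
    define I where "I = (LINT y:\<Omega> \<inter> ball x R|lebesgue. norm (f y) powr q)"
    have I0: "I \<ge> 0" unfolding I_def set_lebesgue_integral_def by (intro integral_nonneg_AE) auto
    have "ennreal I = (\<integral>\<^sup>+y. ennreal (indicator (\<Omega> \<inter> ball x R) y *\<^sub>R norm (f y) powr q) \<partial>lebesgue)"
      unfolding I_def set_lebesgue_integral_def
      by (rule nn_integral_eq_integral[symmetric]) (use int[of x R] in \<open>auto simp: set_integrable_def\<close>)
    also have "\<dots> \<le> ennreal (K * R powr lam)" unfolding norm_eq by (rule nn[OF R])
    finally have "I \<le> K * R powr lam" using \<open>0 \<le> K\<close> by simp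
    then have "I powr (1 / q) \<le> (K * R powr lam) powr (1 / q)"
      using I0 \<open>0 < q\<close> by (intro powr_mono2) auto
    also have "\<dots> = K powr (1 / q) * R powr (lam / q)"
      using \<open>0 \<le> K\<close> by (simp add: powr_mult powr_powr)
    finally have "v \<le> R powr (- lam / q) * (K powr (1 / q) * R powr (lam / q))"
      unfolding v local_Lq_def I_def[symmetric] by (intro mult_left_mono) auto
    also have "\<dots> = K powr (1 / q)" using R by (simp add: powr_minus field_simps)
    finally show ?thesis .
  qed
  have "bdd_above (morrey_vals q lam \<Omega> f)" by (rule bdd_aboveI[OF val])
  then show "in_morrey q lam \<Omega> f"
    unfolding in_morrey_def using meas int by auto
  obtain x where "x \<in> \<Omega>" using \<Omega> by auto
  then have "morrey_vals q lam \<Omega> f \<noteq> {}" unfolding morrey_vals_def using zero_less_one by blast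
  then show "morrey_norm q lam \<Omega> f \<le> K powr (1 / q)"
    unfolding morrey_norm_def using val by (intro cSup_least)
qed

lemma borel_version_integral:
  fixes f :: "'a::euclidean_space \<Rightarrow> real"
  assumes "f \<in> borel_measurable (lebesgue_on \<Omega>)" "\<Omega> \<in> sets borel" "borel_version \<Omega> f f'" "h \<in> borel_measurable borel"
  shows "(LINT x:\<Omega>|lebesgue. f x * h x) = (\<integral>x. f' x * h x \<partial>lborel)"
proof -
  have [measurable]: "(\<lambda>x. indicator \<Omega> x *\<^sub>R f x) \<in> borel_measurable lebesgue"
    using assms by (subst borel_measurable_restrict_space_iff[symmetric]) auto
  have [measurable]: "h \<in> borel_measurable lebesgue" "f' \<in> borel_measurable lebesgue" "f' \<in> borel_measurable borel" "h \<in> borel_measurable borel"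
    using assms by (auto simp: borel_version_def intro: measurable_completion)
  have "(LINT x:\<Omega>|lebesgue. f x * h x) = (\<integral>x. (indicator \<Omega> x *\<^sub>R f x) * h x \<partial>lebesgue)"
    by (simp add: set_lebesgue_integral_def mult.assoc)
  also have "\<dots> = (\<integral>x. f' x * h x \<partial>lebesgue)"
  proof (rule integral_cong_AE)
    have "AE x in lebesgue. indicator \<Omega> x *\<^sub>R f x = f' x"
      using assms(3) by (auto simp: borel_version_def intro: AE_completion)
    then show "AE x in lebesgue. (indicator \<Omega> x *\<^sub>R f x) * h x = f' x * h x" by eventually_elim simp
  qed measurable
  also have "\<dots> = (\<integral>x. f' x * h x \<partial>lborel)"
    by (rule integral_completion) measurable
  finally show ?thesis .
qed

lemma borel_version_inner:
  fixes g :: "'a::euclidean_space \<Rightarrow> 'b::euclidean_space"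
  assumes "borel_version \<Omega> g g'"
  shows "borel_version \<Omega> (\<lambda>x. g x \<bullet> i) (\<lambda>x. g' x \<bullet> i)"
proof -
  have "AE x in lborel. indicator \<Omega> x *\<^sub>R g x = g' x" using assms by (simp add: borel_version_def)
  then have "AE x in lborel. indicator \<Omega> x *\<^sub>R (g x \<bullet> i) = g' x \<bullet> i"
    by eventually_elim (auto simp: indicator_def split: if_splits)
  then show ?thesis using assms by (auto simp: borel_version_def)
qed

text \<open>The point to check is integrability of the gradient: t <= 1 + t^q for t >= 0, and one
  ball containing \<open>\<Omega>\<close> turns the Morrey bound into a finite integral. The rest
  transfers the defining identity to the representatives.\<close>

lemma weak_pair_borel_version:
  fixes f :: "'a::euclidean_space \<Rightarrow> real"
  assumes wg: "weak_grad \<Omega> f g" and f: "set_integrable lebesgue \<Omega> f"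
    and g: "g \<in> borel_measurable (lebesgue_on \<Omega>)"
    and \<Omega>: "open \<Omega>" "bounded \<Omega>" and f': "borel_version \<Omega> f f'" and g': "borel_version \<Omega> g g'"
    and le: "morrey_le q lam UNIV g' K" and "1 \<le> q"
  shows "weak_pair \<Omega> f' g'"
  unfolding weak_pair_def
proof (intro conjI allI impI ballI)
  have \<Omega>b: "\<Omega> \<in> sets borel" using \<Omega> by simp
  have f'm [measurable]: "f' \<in> borel_measurable borel" and g'm [measurable]: "g' \<in> borel_measurable borel"
    using f' g' by (auto simp: borel_version_def)
  have fm: "(\<lambda>x. indicator \<Omega> x *\<^sub>R f x) \<in> borel_measurable lebesgue"
    using f by (auto simp: set_integrable_def dest: borel_measurable_integrable)
  then have fon: "f \<in> borel_measurable (lebesgue_on \<Omega>)"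
    using \<Omega>b by (subst borel_measurable_restrict_space_iff) auto
  have "integrable lebesgue f' \<longleftrightarrow> integrable lebesgue (\<lambda>x. indicator \<Omega> x *\<^sub>R f x)"
  proof (rule integrable_cong_AE)
    show "AE x in lebesgue. f' x = indicator \<Omega> x *\<^sub>R f x"
      using f' by (intro AE_completion) (auto simp: borel_version_def elim: eventually_mono)
    show "f' \<in> borel_measurable lebesgue" by (rule measurable_completion) simp
  qed (rule fm)
  then show "integrable lborel f'"
    using f integrable_completion[of f' lborel] by (simp add: set_integrable_def)
  show "integrable lborel g'"
  proof (rule integrableI_bounded)
    obtain R0 where R0: "R0 > 0" "\<Omega> \<subseteq> ball 0 R0" using bounded_subset_ballD[OF \<Omega>(2), of 0] by auto
    let ?b = "ball 0 R0 :: 'a set"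
    have pt: "ennreal (norm (g' x)) \<le> indicator ?b x + ennreal (norm (g' x) powr q) * indicator (UNIV \<inter> ?b) x" for x
    proof (cases "x \<in> \<Omega>")
      case True
      then have "x \<in> ?b" using R0 by auto
      moreover have "norm (g' x) \<le> 1 + norm (g' x) powr q"
      proof (cases "norm (g' x) \<le> 1")
        case True
        then show ?thesis by (simp add: add_increasing2)
      next
        case False
        then show ?thesis using powr_mono[of 1 q "norm (g' x)"] \<open>1 \<le> q\<close> by simp
      qed
      then have "ennreal (norm (g' x)) \<le> 1 + ennreal (norm (g' x) powr q)"
        using ennreal_leI ennreal_plus[of 1 "norm (g' x) powr q"] by fastforce
      ultimately show ?thesis by simp
    next
      case False
      then show ?thesis using g' by (simp add: borel_version_def)
    qed
    have "(\<integral>\<^sup>+x. ennreal (norm (g' x)) \<partial>lborel)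
      \<le> (\<integral>\<^sup>+x. indicator ?b x + ennreal (norm (g' x) powr q) * indicator (UNIV \<inter> ?b) x \<partial>lborel)"
      using pt by (intro nn_integral_mono)
    also have "\<dots> = emeasure lborel ?b + (\<integral>\<^sup>+x. ennreal (norm (g' x) powr q) * indicator (UNIV \<inter> ?b) x \<partial>lborel)"
      by (subst nn_integral_add) auto
    also have "\<dots> < \<infinity>"
      using emeasure_bounded_finite[of ?b] le_less_trans[OF morrey_leD[OF le R0(1), of 0] ennreal_less_top]
      by (auto simp: less_top)
    finally show "(\<integral>\<^sup>+x. ennreal (norm (g' x)) \<partial>lborel) < \<infinity>" .
  qed simp
  fix \<phi> :: "'a \<Rightarrow> real" and i :: 'a assume \<phi>: "C0inf \<Omega> \<phi>" and i: "i \<in> Basis"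
  have gi: "(\<lambda>x. g x \<bullet> i) \<in> borel_measurable (lebesgue_on \<Omega>)" using g by measurable
  have "(LINT x:\<Omega>|lebesgue. f x * frechet_derivative \<phi> (at x) i) = - (LINT x:\<Omega>|lebesgue. (g x \<bullet> i) * \<phi> x)"
    using wg \<phi> i by (simp add: weak_grad_def)
  then show "(\<integral>x. f' x * frechet_derivative \<phi> (at x) i \<partial>lborel) = - (\<integral>x. (g' x \<bullet> i) * \<phi> x \<partial>lborel)"
    using borel_version_integral[OF fon \<Omega>b f' C0inf_measurable(2)[OF \<phi>, of i]]
      borel_version_integral[OF gi \<Omega>b borel_version_inner[OF g'] C0inf_measurable(1)[OF \<phi>]] by simp
qed

subsection \<open>The two cases of the theorem\<close>

text \<open>Lets the approximation error tend to 0 while \<open>f\<close> stays fixed. The slack is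
  e divided by \<open>R powr lam\<close>, which may depend on the ball.\<close>

lemma morrey_le_limit:
  assumes "\<And>\<delta>. \<delta> > 0 \<Longrightarrow> morrey_le q lam A f (K + \<delta>)" "0 \<le> K"
  shows "morrey_le q lam A f K"
  unfolding morrey_le_def
proof (intro allI impI)
  fix x and R :: real assume R: "R > 0"
  show "(\<integral>\<^sup>+y. ennreal (norm (f y) powr q) * indicator (A \<inter> ball x R) y \<partial>lborel) \<le> ennreal (K * R powr lam)"
  proof (rule ennreal_le_epsilon)
    fix e :: real assume "0 < e"
    define \<delta> where "\<delta> = e / R powr lam"
    have "\<delta> > 0" using \<open>0 < e\<close> R by (simp add: \<delta>_def)
    then have "(\<integral>\<^sup>+y. ennreal (norm (f y) powr q) * indicator (A \<inter> ball x R) y \<partial>lborel) \<le> ennreal ((K + \<delta>) * R powr lam)"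
      using R by (intro morrey_leD assms(1))
    also have "(K + \<delta>) * R powr lam = K * R powr lam + e" using R by (simp add: \<delta>_def field_simps)
    also have "ennreal \<dots> = ennreal (K * R powr lam) + ennreal e"
      using assms(2) \<open>0 < e\<close> by (simp add: ennreal_plus)
    finally show "(\<integral>\<^sup>+y. ennreal (norm (f y) powr q) * indicator (A \<inter> ball x R) y \<partial>lborel) \<le> ennreal (K * R powr lam) + ennreal e" .
  qed
qed

text \<open>A test function is smooth on the whole space, so the classical identity holds along
  segments that leave \<open>\<Omega>\<close>. At the far end it vanishes: two points of the open
  ball of radius \<open>R0\<close> cannot differ by a vector of length
  \<open>2 * R0\<close>.\<close>

lemma C0inf_friedrichs:
  fixes \<phi> :: "'a::euclidean_space \<Rightarrow> real"
  assumes \<phi>: "C0inf \<Omega> \<phi>" and \<Omega>: "\<Omega> \<subseteq> ball 0 R0" and le: "morrey_le q lam UNIV (grad \<phi>) K" and "1 \<le> q" "0 \<le> K" "0 < R0"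
    and [measurable]: "grad \<phi> \<in> borel_measurable borel"
  shows "morrey_le q lam \<Omega> \<phi> ((2 * R0) powr q * K)"
proof -
  obtain i :: 'a where i: "i \<in> Basis" using nonempty_Basis by blast
  define v where "v = (2 * R0) *\<^sub>R i"
  have v: "norm v = 2 * R0" using i \<open>0 < R0\<close> by (simp add: v_def)
  have "- \<phi> x = (\<integral>s. grad \<phi> (x + s *\<^sub>R v) \<bullet> v \<partial>unit_interval_measure)" if "x \<in> \<Omega>" for x
  proof -
    have x: "norm x < R0" using that \<Omega> by auto
    have "x + v \<notin> \<Omega>"
    proof
      assume "x + v \<in> \<Omega>"
      then have "norm (x + v) < R0" using \<Omega> by auto
      then show False using x v norm_triangle_ineq4[of "x + v" x] by simp
    qed
    then have "\<phi> (x + v) = 0"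
      using \<phi> closure_subset[of "{x. \<phi> x \<noteq> 0}"] by (auto simp: C0inf_def tsupport_def)
    then show ?thesis
      using fundamental_theorem_segment[of \<phi> x v] \<phi>
      by (simp add: C0inf_def grad_inner smooth_imp_differentiable)
  qed
  then have "morrey_le q lam \<Omega> (\<lambda>x. - \<phi> x) (norm v powr q * K)"
    using assms by (intro morrey_le_line_integral[of "grad \<phi>"]) auto
  then show ?thesis unfolding v by (rule morrey_le_mono) (use \<open>1 \<le> q\<close> in auto)
qed

text \<open>As \<open>f\<close> has integral 0 over \<open>S\<close>, the mean of f - c over
  \<open>S\<close> is -c. Jensen bounds |c|^q by the mean of |f - c|^q, and the Morrey bound on one
  large ball controls that mean.\<close>

lemma mean_zero_constant_bound:
  fixes f :: "'a::euclidean_space \<Rightarrow> real"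
  assumes f: "integrable lborel f" and S: "S \<in> sets borel" "S \<subseteq> \<Omega>" "emeasure lborel S > 0" "\<Omega> \<subseteq> ball 0 R0" "0 < R0"
    and mean: "(\<integral>x. f x * indicator S x \<partial>lborel) = 0"
    and le: "morrey_le q lam \<Omega> (\<lambda>x. f x - c) K" and "0 \<le> K" "1 \<le> q"
  shows "\<bar>c\<bar> powr q \<le> K * R0 powr lam / measure lborel S"
proof -
  have "bounded S" using S bounded_subset[OF bounded_ball] by blast
  note m = emeasure_pos_finite[OF this S(3)]
  have [measurable]: "f \<in> borel_measurable borel" using f by (auto dest: borel_measurable_integrable)
  let ?M = "density lborel (\<lambda>x. ennreal (indicator S x / measure lborel S))"
  have nn: "(\<integral>\<^sup>+x. h x \<partial>?M) = inverse (ennreal (measure lborel S)) * (\<integral>\<^sup>+x. h x * indicator S x \<partial>lborel)"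
    if [measurable]: "h \<in> borel_measurable borel" for h
  proof -
    have "(\<integral>\<^sup>+x. h x \<partial>?M) = (\<integral>\<^sup>+x. inverse (ennreal (measure lborel S)) * (h x * indicator S x) \<partial>lborel)"
      using S(1) m by (subst nn_integral_density)
        (auto intro!: nn_integral_cong simp: indicator_def inverse_ennreal divide_inverse)
    then show ?thesis using S(1) by (simp add: nn_integral_cmult)
  qed
  interpret M: prob_space ?M
  proof (rule prob_spaceI)
    have "emeasure ?M (space ?M) = (\<integral>\<^sup>+x. 1 \<partial>?M)" by simp
    also have "\<dots> = 1"
      using S(1) m by (subst nn) (auto simp: inverse_ennreal ennreal_mult[symmetric])
    finally show "emeasure ?M (space ?M) = 1" .
  qed
  have fS: "integrable lborel (\<lambda>x. f x * indicator S x)"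
    using integrable_mult_indicator[OF _ f, of S] S(1) by (simp add: mult.commute)
  have iS: "integrable lborel (\<lambda>x. indicator S x :: real)" using S(1) m by (intro integrable_real_indicator) auto
  have "integral\<^sup>L ?M (\<lambda>x. f x - c) = (\<integral>x. (f x * indicator S x - c * indicator S x) / measure lborel S \<partial>lborel)"
    using S(1) m by (subst integral_density) (auto intro!: Bochner_Integration.integral_cong simp: algebra_simps diff_divide_distrib)
  also have "\<dots> = - c"
    using fS iS mean m S(1) by simp
  finally have "ennreal (\<bar>c\<bar> powr q) \<le> (\<integral>\<^sup>+x. ennreal (\<bar>f x - c\<bar> powr q) \<partial>?M)"
    using M.abs_integral_powr_le_nn_integral[of "\<lambda>x. f x - c" q] \<open>1 \<le> q\<close> by simp
  also have "\<dots> = inverse (ennreal (measure lborel S)) * (\<integral>\<^sup>+x. ennreal (\<bar>f x - c\<bar> powr q) * indicator S x \<partial>lborel)"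
    by (rule nn) measurable
  also have "\<dots> \<le> inverse (ennreal (measure lborel S)) * ennreal (K * R0 powr lam)"
  proof (rule mult_left_mono)
    have "(\<integral>\<^sup>+x. ennreal (\<bar>f x - c\<bar> powr q) * indicator S x \<partial>lborel)
      \<le> (\<integral>\<^sup>+x. ennreal (norm (f x - c) powr q) * indicator (\<Omega> \<inter> ball 0 R0) x \<partial>lborel)"
      using S by (intro nn_integral_mono) (auto simp: indicator_def)
    also have "\<dots> \<le> ennreal (K * R0 powr lam)" using le S(5) by (rule morrey_leD)
    finally show "(\<integral>\<^sup>+x. ennreal (\<bar>f x - c\<bar> powr q) * indicator S x \<partial>lborel) \<le> ennreal (K * R0 powr lam)" .
  qed simp
  also have "\<dots> = ennreal (K * R0 powr lam / measure lborel S)"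
    using m \<open>0 \<le> K\<close> by (simp add: inverse_ennreal ennreal_mult[symmetric] divide_inverse mult.commute)
  finally show ?thesis using m \<open>0 \<le> K\<close> by simp
qed

text \<open>The function is recovered as (f - c) + c, where both terms have Morrey bounds; this is
  how a merely integrable \<open>f\<close> is shown to lie in the space.\<close>

lemma poincare_mean_zero:
  fixes \<Omega> U :: "'a::euclidean_space set" and q lam :: real
  assumes bd: "bounded \<Omega>" and conn: "connected \<Omega>" and lip: "lipschitz_domain \<Omega>"
    and q: "1 < q" and lam: "0 \<le> lam" "lam \<le> real DIM('a)"
    and U: "U \<subseteq> \<Omega>" "U \<in> sets lebesgue" "emeasure lebesgue U > 0"
  obtains c where "c \<ge> 0" "\<And>(f::'a \<Rightarrow> real) (g::'a \<Rightarrow> 'a). weak_grad \<Omega> f g \<Longrightarrow> set_integrable lebesgue \<Omega> f \<Longrightarrow>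
    in_morrey q lam \<Omega> g \<Longrightarrow> (LINT x:U|lebesgue. f x) = 0 \<Longrightarrow>
    in_morrey q lam \<Omega> f \<and> morrey_norm q lam \<Omega> f \<le> c * morrey_norm q lam \<Omega> g"
proof -
  have op: "open \<Omega>" using lip by (simp add: lipschitz_domain_def)
  then have \<Omega>b [measurable]: "\<Omega> \<in> sets borel" by simp
  have ne: "\<Omega> \<noteq> {}" using U by auto
  have q1: "1 \<le> q" using q by simp
  obtain C where C: "C \<ge> 0" "\<And>f g K. weak_pair \<Omega> f g \<Longrightarrow> 0 \<le> K \<Longrightarrow> morrey_le q lam UNIV g K \<Longrightarrow>
     \<exists>c. morrey_le q lam \<Omega> (\<lambda>x. f x - c) (C * K)"
    using lipschitz_domain_poincare[OF bd conn lip ne q1 lam] unfolding poincare_set_def by blast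
  obtain M where M: "M > 0" "\<And>x R. R > 0 \<Longrightarrow> emeasure lborel (\<Omega> \<inter> ball x R) \<le> ennreal (M * R powr lam)"
    using bounded_measure_ball_le[OF bd \<Omega>b lam] by blast
  obtain R0 where R0: "R0 > 0" "\<Omega> \<subseteq> ball 0 R0" using bounded_subset_ballD[OF bd, of 0] by auto
  \<comment> \<open>\<open>U\<close> is only Lebesgue measurable. Its Borel part \<open>S\<close>
    differs from it by a null set, so it still has positive measure and carries the same
    integral.\<close>
  obtain S N N' where SN: "U = S \<union> N" "N \<subseteq> N'" "N' \<in> null_sets lborel" "S \<in> sets lborel"
    using sets_completionE[OF U(2)] by blast
  have AES: "AE x in lborel. x \<in> U \<longleftrightarrow> x \<in> S"
    using AE_not_in[OF SN(3)] by eventually_elim (use SN in auto)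
  have Sb [measurable]: "S \<in> sets borel" using SN by simp
  have "emeasure lborel S \<noteq> 0"
  proof
    assume "emeasure lborel S = 0"
    then have "S \<union> N' \<in> null_sets lborel" using SN by (intro null_sets.Un) (auto simp: null_sets_def)
    then have "U \<in> null_sets lebesgue" using SN U(2) by (auto intro: null_sets_completion_subset null_sets_completionI)
    then show False using U(3) by (auto simp: null_sets_def)
  qed
  then have Spos: "emeasure lborel S > 0" by (simp add: zero_less_iff_neq_zero)
  define m where "m = measure lborel S"
  have "S \<subseteq> \<Omega>" using SN U by auto
  then have m: "m > 0" unfolding m_def using bd Spos by (intro emeasure_pos_finite) (auto intro: bounded_subset)
  \<comment> \<open>The terms stand for f - c and for the constant \<open>c\<close>;
    \<open>2 powr q\<close> pays for adding them, and the last \<open>2 powr lam\<close> for the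
    change of centres in the bound of the gradient.\<close>
  define E where "E = 2 powr q * (C + C * R0 powr lam / m * M) * 2 powr lam"
  have E: "E \<ge> 0" unfolding E_def using C M m by simp
  show ?thesis
  proof (rule that[of "E powr (1 / q)"])
    fix f :: "'a \<Rightarrow> real" and g :: "'a \<Rightarrow> 'a"
    assume wg: "weak_grad \<Omega> f g" and f: "set_integrable lebesgue \<Omega> f" and g: "in_morrey q lam \<Omega> g"
      and mean: "(LINT x:U|lebesgue. f x) = 0"
    have fm [measurable]: "(\<lambda>x. indicator \<Omega> x *\<^sub>R f x) \<in> borel_measurable lebesgue"
      using f by (auto simp: set_integrable_def dest: borel_measurable_integrable)
    then have fon: "f \<in> borel_measurable (lebesgue_on \<Omega>)"
      using \<Omega>b by (subst borel_measurable_restrict_space_iff) auto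
    have gon: "g \<in> borel_measurable (lebesgue_on \<Omega>)" using g by (simp add: in_morrey_def)
    obtain f' where f': "borel_version \<Omega> f f'" using ex_borel_version[OF fon \<Omega>b] by blast
    obtain g' where g': "borel_version \<Omega> g g'" using ex_borel_version[OF gon \<Omega>b] by blast
    define n where "n = morrey_norm q lam \<Omega> g"
    have n: "n \<ge> 0" unfolding n_def by (rule morrey_norm_nonneg[OF g ne])
    define K where "K = 2 powr lam * n powr q"
    have K: "K \<ge> 0" by (simp add: K_def)
    have gle: "morrey_le q lam UNIV g' K"
      unfolding K_def n_def using q lam by (intro in_morrey_imp_morrey_le[OF g _ _ g' ne]) auto
    have wp: "weak_pair \<Omega> f' g'"
      by (rule weak_pair_borel_version[OF wg f gon op bd f' g' gle q1])
    note [measurable] = weak_pair_measurable[OF wp]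
    obtain c where c: "morrey_le q lam \<Omega> (\<lambda>x. f' x - c) (C * K)" using C(2)[OF wp K gle] by blast
    have "(LINT x:U|lebesgue. f x) = (\<integral>x. f' x * indicator S x \<partial>lebesgue)"
      unfolding set_lebesgue_integral_def
    proof (rule integral_cong_AE)
      have "(\<lambda>x. indicator U x *\<^sub>R f x) = (\<lambda>x. indicator U x * (indicator \<Omega> x *\<^sub>R f x))"
        using U(1) by (auto simp: fun_eq_iff indicator_def)
      then show "(\<lambda>x. indicator U x *\<^sub>R f x) \<in> borel_measurable lebesgue" using U(2) fm by simp
      show "(\<lambda>x. f' x * indicator S x) \<in> borel_measurable lebesgue" by (rule measurable_completion) simp
      have "AE x in lborel. indicator \<Omega> x *\<^sub>R f x = f' x" using f' by (simp add: borel_version_def)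
      with AES have "AE x in lborel. indicator U x *\<^sub>R f x = f' x * indicator S x"
        by eventually_elim (use U(1) in \<open>auto simp: indicator_def split: if_splits\<close>)
      then show "AE x in lebesgue. indicator U x *\<^sub>R f x = f' x * indicator S x" by (rule AE_completion)
    qed
    also have "\<dots> = (\<integral>x. f' x * indicator S x \<partial>lborel)" by (rule integral_completion) simp
    finally have mean': "(\<integral>x. f' x * indicator S x \<partial>lborel) = 0" using mean by simp
    have "\<bar>c\<bar> powr q \<le> C * K * R0 powr lam / m"
      unfolding m_def using wp C K q1
      by (intro mean_zero_constant_bound[OF _ Sb \<open>S \<subseteq> \<Omega>\<close> Spos R0(2,1) mean' c]) (auto simp: weak_pair_def)
    then have cM: "norm c powr q * M \<le> C * K * R0 powr lam / m * M"
      using M by (intro mult_right_mono) auto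
    have cle: "morrey_le q lam \<Omega> (\<lambda>_. c) (C * K * R0 powr lam / m * M)"
      by (rule morrey_le_mono[OF morrey_le_const[OF M(2) \<Omega>b M(1)] cM]) (use q in auto)
    have "morrey_le q lam \<Omega> (\<lambda>x. (f' x - c) + c) (2 powr q * (C * K + C * K * R0 powr lam / m * M))"
      by (rule morrey_le_add[OF _ _ _ c cle]) (use q C K M m in auto)
    moreover have "2 powr q * (C * K + C * K * R0 powr lam / m * M) = E * n powr q"
      by (simp add: E_def K_def algebra_simps)
    ultimately have fle: "morrey_le q lam \<Omega> f' (E * n powr q)" by simp
    have "in_morrey q lam \<Omega> f" "morrey_norm q lam \<Omega> f \<le> (E * n powr q) powr (1 / q)"
      using morrey_le_imp_in_morrey[OF fon \<Omega>b ne f' fle] E q by auto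
    moreover have "(E * n powr q) powr (1 / q) = E powr (1 / q) * n"
      using E n q by (simp add: powr_mult powr_powr)
    ultimately show "in_morrey q lam \<Omega> f \<and> morrey_norm q lam \<Omega> f \<le> E powr (1 / q) * morrey_norm q lam \<Omega> g"
      by (simp add: n_def)
  qed simp
qed

text \<open>The limit is taken in the estimate: \<open>f\<close> is split as (f - phi) + phi with a
  test function phi close in both norms, the inequality for test functions is applied to phi, and
  grad phi is in turn compared with \<open>g\<close>.\<close>

lemma friedrichs_W10_zorko:
  fixes \<Omega> :: "'a::euclidean_space set" and q lam :: real
  assumes bd: "bounded \<Omega>" and op: "open \<Omega>" and ne: "\<Omega> \<noteq> {}"
    and q: "1 < q" and lam: "0 \<le> lam"
  obtains c where "c \<ge> 0" "\<And>(f::'a \<Rightarrow> real) (g::'a \<Rightarrow> 'a). in_W10_zorko q lam \<Omega> f g \<Longrightarrow>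
    in_morrey q lam \<Omega> f \<and> morrey_norm q lam \<Omega> f \<le> c * morrey_norm q lam \<Omega> g"
proof -
  have \<Omega>b [measurable]: "\<Omega> \<in> sets borel" using op by simp
  have q1: "1 \<le> q" using q by simp
  obtain R0 where R0: "R0 > 0" "\<Omega> \<subseteq> ball 0 R0" using bounded_subset_ballD[OF bd, of 0] by auto
  \<comment> \<open>The estimates below add up to b n^q + a eps^q. \<open>b\<close> collects two
    additions, the constant for test functions and the change of centres; \<open>a\<close> has one
    more term, due to f - phi.\<close>
  define b where "b = 2 powr q * ((2 * R0) powr q * (2 powr q * 2 powr lam))"
  define a where "a = 2 powr q * 2 powr lam + b"
  have b: "b \<ge> 0" and a: "a > 0" unfolding a_def b_def by (auto intro!: add_pos_nonneg)
  show ?thesis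
  proof (rule that[of "b powr (1 / q)"])
    fix f :: "'a \<Rightarrow> real" and g :: "'a \<Rightarrow> 'a"
    assume W: "in_W10_zorko q lam \<Omega> f g"
    have f: "in_morrey q lam \<Omega> f" and g: "in_morrey q lam \<Omega> g"
      using W by (auto simp: in_W10_zorko_def in_zorko_def)
    have fon: "f \<in> borel_measurable (lebesgue_on \<Omega>)" and gon: "g \<in> borel_measurable (lebesgue_on \<Omega>)"
      using f g by (auto simp: in_morrey_def)
    obtain f' where f': "borel_version \<Omega> f f'" using ex_borel_version[OF fon \<Omega>b] by blast
    obtain g' where g': "borel_version \<Omega> g g'" using ex_borel_version[OF gon \<Omega>b] by blast
    have [measurable]: "f' \<in> borel_measurable borel" "g' \<in> borel_measurable borel"
      using f' g' by (auto simp: borel_version_def)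
    define n where "n = morrey_norm q lam \<Omega> g"
    have n: "n \<ge> 0" unfolding n_def by (rule morrey_norm_nonneg[OF g ne])
    have gle: "morrey_le q lam UNIV g' (2 powr lam * n powr q)"
      unfolding n_def using q lam by (intro in_morrey_imp_morrey_le[OF g _ _ g' ne]) auto
    have fle: "morrey_le q lam \<Omega> f' (b * n powr q)"
    proof (rule morrey_le_limit)
      fix \<delta> :: real assume \<delta>: "\<delta> > 0"
      \<comment> \<open>Chosen so that the total error a eps^q is exactly
        \<open>\<delta>\<close>.\<close>
      define \<epsilon> where "\<epsilon> = (\<delta> / a) powr (1 / q)"
      have \<epsilon>: "\<epsilon> > 0" using \<delta> a by (simp add: \<epsilon>_def)
      have \<epsilon>q: "a * \<epsilon> powr q = \<delta>" using \<delta> a q by (simp add: \<epsilon>_def powr_powr)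
      obtain \<phi> where \<phi>: "C0inf \<Omega> \<phi>"
        and fd: "in_morrey q lam \<Omega> (\<lambda>x. f x - \<phi> x)" and gd: "in_morrey q lam \<Omega> (\<lambda>x. g x - grad \<phi> x)"
        and small: "max (morrey_norm q lam \<Omega> (\<lambda>x. f x - \<phi> x)) (morrey_norm q lam \<Omega> (\<lambda>x. g x - grad \<phi> x)) < \<epsilon>"
        using W \<epsilon> unfolding in_W10_zorko_def by blast
      have \<phi>m [measurable]: "\<phi> \<in> borel_measurable borel" by (rule C0inf_measurable[OF \<phi>])
      have gm [measurable]: "grad \<phi> \<in> borel_measurable borel"
        unfolding grad_def[abs_def] using C0inf_measurable(2)[OF \<phi>] by measurable
      have \<phi>out: "\<phi> x = 0" "grad \<phi> x = 0" if "x \<notin> \<Omega>" for x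
      proof -
        have "x \<notin> tsupport \<phi>" using \<phi> that by (auto simp: C0inf_def)
        then show "\<phi> x = 0" "grad \<phi> x = 0"
          using closure_subset[of "{x. \<phi> x \<noteq> 0}"] by (auto simp: tsupport_def grad_def frechet_derivative_outside_tsupport)
      qed
      have pw: "r powr q \<le> \<epsilon> powr q" if "0 \<le> r" "r < \<epsilon>" for r using that q by (intro powr_mono2) auto
      have 1: "morrey_le q lam UNIV (\<lambda>x. f' x - \<phi> x) (2 powr lam * \<epsilon> powr q)"
      proof (rule morrey_le_mono[OF in_morrey_imp_morrey_le[OF fd _ lam borel_version_diff[OF f' \<phi>m \<phi>out(1)] ne]])
        show "2 powr lam * morrey_norm q lam \<Omega> (\<lambda>x. f x - \<phi> x) powr q \<le> 2 powr lam * \<epsilon> powr q"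
          using small morrey_norm_nonneg[OF fd ne] by (intro mult_left_mono pw) auto
      qed (use q in auto)
      \<comment> \<open>The sign prepares grad phi = g' + -(g' - grad phi), a sum to which
        \<open>morrey_le_add\<close> applies.\<close>
      have 2: "morrey_le q lam UNIV (\<lambda>x. - (g' x - grad \<phi> x)) (2 powr lam * \<epsilon> powr q)"
      proof (rule morrey_le_mono[OF in_morrey_imp_morrey_le[OF gd _ lam borel_version_diff[OF g' gm \<phi>out(2)] ne]])
        show "2 powr lam * morrey_norm q lam \<Omega> (\<lambda>x. g x - grad \<phi> x) powr q \<le> 2 powr lam * \<epsilon> powr q"
          using small morrey_norm_nonneg[OF gd ne] by (intro mult_left_mono pw) auto
      qed (use q in \<open>auto simp: norm_minus_commute\<close>)
      have "morrey_le q lam UNIV (\<lambda>x. g' x + - (g' x - grad \<phi> x)) (2 powr q * (2 powr lam * n powr q + 2 powr lam * \<epsilon> powr q))"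
        by (rule morrey_le_add[OF _ _ _ gle 2]) (use q in auto)
      then have gr: "morrey_le q lam UNIV (grad \<phi>) (2 powr q * (2 powr lam * n powr q + 2 powr lam * \<epsilon> powr q))" by simp
      have 3: "morrey_le q lam \<Omega> \<phi> ((2 * R0) powr q * (2 powr q * (2 powr lam * n powr q + 2 powr lam * \<epsilon> powr q)))"
        by (rule C0inf_friedrichs[OF \<phi> R0(2) gr]) (use q R0 in auto)
      have 4: "morrey_le q lam \<Omega> (\<lambda>x. f' x - \<phi> x) (2 powr lam * \<epsilon> powr q)"
        by (rule morrey_le_mono[OF 1]) (use q in auto)
      have "morrey_le q lam \<Omega> (\<lambda>x. (f' x - \<phi> x) + \<phi> x) (2 powr q * (2 powr lam * \<epsilon> powr q +
          (2 * R0) powr q * (2 powr q * (2 powr lam * n powr q + 2 powr lam * \<epsilon> powr q))))"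
        by (rule morrey_le_add[OF _ _ _ 4 3]) (use q in auto)
      moreover have "2 powr q * (2 powr lam * \<epsilon> powr q +
          (2 * R0) powr q * (2 powr q * (2 powr lam * n powr q + 2 powr lam * \<epsilon> powr q))) = b * n powr q + a * \<epsilon> powr q"
        by (simp add: a_def b_def algebra_simps)
      ultimately show "morrey_le q lam \<Omega> f' (b * n powr q + \<delta>)" by (simp add: \<epsilon>q)
    qed (use b in simp)
    have "morrey_norm q lam \<Omega> f \<le> (b * n powr q) powr (1 / q)"
      using morrey_le_imp_in_morrey(2)[OF fon \<Omega>b ne f' fle] b q by auto
    moreover have "(b * n powr q) powr (1 / q) = b powr (1 / q) * n"
      using b n q by (simp add: powr_mult powr_powr)
    ultimately show "in_morrey q lam \<Omega> f \<and> morrey_norm q lam \<Omega> f \<le> b powr (1 / q) * morrey_norm q lam \<Omega> g"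
      using f by (simp add: n_def)
  qed simp
qed

theorem mainTheorem12:
  fixes \<Omega> U :: "'a::euclidean_space set" and q lam :: real
  assumes "bounded \<Omega>" and "connected \<Omega>" and "lipschitz_domain \<Omega>"
    and "1 < q" and "0 \<le> lam" and "lam < real DIM('a)"
    and "U \<subseteq> \<Omega>" and "U \<in> sets lebesgue" and "emeasure lebesgue U > 0"
  shows "\<exists>c>0. \<forall>(f::'a \<Rightarrow> real) (g::'a \<Rightarrow> 'a). weak_grad \<Omega> f g \<longrightarrow>
           ((set_integrable lebesgue \<Omega> f \<and> in_zorko q lam \<Omega> g \<and> (LINT x:U|lebesgue. f x) = 0)
            \<or> in_W10_zorko q lam \<Omega> f g) \<longrightarrow>
           in_morrey q lam \<Omega> f \<and> morrey_norm q lam \<Omega> f \<le> c * morrey_norm q lam \<Omega> g"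
proof -
  have op: "open \<Omega>" using assms(3) by (simp add: lipschitz_domain_def)
  have ne: "\<Omega> \<noteq> {}" using assms(7,9) by auto
  obtain c where c: "c \<ge> 0" "\<And>(f::'a \<Rightarrow> real) (g::'a \<Rightarrow> 'a). weak_grad \<Omega> f g \<Longrightarrow> set_integrable lebesgue \<Omega> f \<Longrightarrow>
    in_morrey q lam \<Omega> g \<Longrightarrow> (LINT x:U|lebesgue. f x) = 0 \<Longrightarrow>
    in_morrey q lam \<Omega> f \<and> morrey_norm q lam \<Omega> f \<le> c * morrey_norm q lam \<Omega> g"
    using poincare_mean_zero[OF assms(1-5) less_imp_le[OF assms(6)] assms(7-9)] by blast
  obtain d where d: "d \<ge> 0" "\<And>(f::'a \<Rightarrow> real) (g::'a \<Rightarrow> 'a). in_W10_zorko q lam \<Omega> f g \<Longrightarrow>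
    in_morrey q lam \<Omega> f \<and> morrey_norm q lam \<Omega> f \<le> d * morrey_norm q lam \<Omega> g"
    using friedrichs_W10_zorko[OF assms(1) op ne assms(4,5)] by blast
  show ?thesis
  \<comment> \<open>The sum dominates the constants of both alternatives, and the summand 1 makes it
    positive even if both vanish. Enlarging the constant is legitimate because the norm of
    \<open>g\<close> is nonnegative.\<close>
  proof (rule exI[of _ "c + d + 1"], intro conjI allI impI)
    show "c + d + 1 > 0" using c d by simp
    fix f :: "'a \<Rightarrow> real" and g :: "'a \<Rightarrow> 'a"
    assume wg: "weak_grad \<Omega> f g"
      and "(set_integrable lebesgue \<Omega> f \<and> in_zorko q lam \<Omega> g \<and> (LINT x:U|lebesgue. f x) = 0) \<or> in_W10_zorko q lam \<Omega> f g"
    then consider (mean) "set_integrable lebesgue \<Omega> f" "in_zorko q lam \<Omega> g" "(LINT x:U|lebesgue. f x) = 0"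
      | (W10) "in_W10_zorko q lam \<Omega> f g" by blast
    then have *: "in_morrey q lam \<Omega> g \<and> in_morrey q lam \<Omega> f \<and>
      (morrey_norm q lam \<Omega> f \<le> c * morrey_norm q lam \<Omega> g \<or> morrey_norm q lam \<Omega> f \<le> d * morrey_norm q lam \<Omega> g)"
    proof cases
      case mean
      then show ?thesis using c(2)[OF wg] by (auto simp: in_zorko_def)
    next
      case W10
      then have "in_morrey q lam \<Omega> g" by (simp add: in_W10_zorko_def in_zorko_def)
      then show ?thesis using d(2)[OF W10] by blast
    qed
    then show "in_morrey q lam \<Omega> f" by blast
    have "morrey_norm q lam \<Omega> g \<ge> 0" using * morrey_norm_nonneg[OF _ ne] by blast
    then have "c * morrey_norm q lam \<Omega> g \<le> (c + d + 1) * morrey_norm q lam \<Omega> g"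
      "d * morrey_norm q lam \<Omega> g \<le> (c + d + 1) * morrey_norm q lam \<Omega> g"
      using c(1) d(1) by (auto intro!: mult_right_mono)
    then show "morrey_norm q lam \<Omega> f \<le> (c + d + 1) * morrey_norm q lam \<Omega> g" using * by linarith
  qed
qed

end
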